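(* Let $\Sigma=\{1,\dots,N\}$ with $N\in\mathbb{N}$, or $\Sigma=\mathbb{N}$ (the case $N=\infty$), and let $\Lambda\subset\mathbb{R}$ be an interval. Let $A\in[0,\infty)$, $c,d\in\mathbb{R}$, and put $h(x)=(A/2)x^2+cx+d$ for $x\in\mathbb{R}$. Suppose that $\mathcal{L}$ is a $\Sigma$-indexed line ensemble on $\Lambda$ and define the $\Sigma$-indexed line ensemble $\tilde{\mathcal{L}}$ on $\Lambda$ by $$\tilde{\mathcal{L}}_i(s)=\mathcal{L}_i(s)+h(s)\quad\text{for } s\in\Lambda \text{ and } i\in\Sigma.$$ Then $\mathcal{L}$ satisfies the partial Brownian Gibbs property if and only if $\tilde{\mathcal{L}}$ satisfies the partial Brownian Gibbs property with respect to $\vec{A}$-area tilts, where $A_i=A$ for all $i\in\Sigma$.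
   Context: Line ensembles. For $\Sigma\subset\mathbb{Z}$ (discrete topology) and an interval $\Lambda\subset\mathbb{R}$, $C(\Sigma\times\Lambda)$ is the space of continuous functions $\Sigma\times\Lambda\to\mathbb{R}$ with the topology of uniform convergence on compact sets and its Borel $\sigma$-algebra. A $\Sigma$-indexed line ensemble $\mathcal{L}$ on $\Lambda$ is a $C(\Sigma\times\Lambda)$-valued random variable on a probability space $(\Omega,\mathcal{F},\mathbb{P})$; $\mathcal{L}_i=\mathcal{L}(i,\cdot)$. It is non-intersecting if $\mathbb{P}$-almost surely $\mathcal{L}_i(r)>\mathcal{L}_j(r)$ for all $i<j$ in $\Sigma$ and all $r\in\Lambda$. Free and avoiding laws. Let $k_1\le k_2$ be integers, $k=k_2-k_1+1$, $a<b$ real, and $W_k^\circ=\{\vec{x}\in\mathbb{R}^k:x_1>\cdots>x_k\}$. For $\vec{x},\vec{y}\in\mathbb{R}^k$, $\mathbb{P}_{\mathrm{free}}^{k_1,k_2,a,b,\vec{x},\vec{y}}$ is the law on $C(\{k_1,\dots,k_2\}\times[a,b])$ of $k$ independent Brownian bridges $B_{k_1},\dots,B_{k_2}$ with diffusion parameter $1$ (i.e. standard Brownian motion bridges), $B_i(a)=x_{i-k_1+1}$, $B_i(b)=y_{i-k_1+1}$. Let $\vec{x},\vec{y}\in W_k^\circ$ and let $f:[a,b]\to(-\infty,\infty]$, $g:[a,b]\to[-\infty,\infty)$ be continuous, meaning $f$ is real-valued continuous or $f\equiv\infty$, and $g$ is real-valued continuous or $g\equiv-\infty$; assume $f>g$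 on $[a,b]$, $f(a)>x_1$, $f(b)>y_1$, $g(a)<x_k$, $g(b)<y_k$. Then $\mathbb{P}_{\mathrm{avoid}}^{k_1,k_2,a,b,\vec{x},\vec{y},f,g}$ is $\mathbb{P}_{\mathrm{free}}^{k_1,k_2,a,b,\vec{x},\vec{y}}$ conditioned on the (positive probability) event $\{f(r)>B_{k_1}(r)>\cdots>B_{k_2}(r)>g(r)\text{ for all }r\in[a,b]\}$. Area-tilted law. With the same data, $g\neq-\infty$, and $\vec{A}=(A_{k_1},\dots,A_{k_2})\in[0,\infty)^k$, $\mathbb{P}_{\mathrm{avoid},\vec{A}}^{k_1,k_2,a,b,\vec{x},\vec{y},f,g}$ is the probability measure with density, with respect to $\mathbb{P}_{\mathrm{avoid}}^{k_1,k_2,a,b,\vec{x},\vec{y},f,g}$, proportional to $\exp\big(-\sum_{i=k_1}^{k_2}\int_a^bA_i(\mathcal{Q}_i(u)-g(u))\,du\big)$; its expectation is $\mathbb{E}_{\mathrm{avoid},\vec{A}}^{k_1,k_2,a,b,\vec{x},\vec{y},f,g}$. Gibbs property. Let $\Sigma=\{1,\dots,N\}$ with $N\in\mathbb{N}$ or $\Sigma=\mathbb{N}$ ($N=\infty$), and $\vec{A}=\{A_i\}_{i\in\Sigma}$ with $A_i\in[0,\infty)$. A $\Sigma$-indexed line ensemble $\mathcal{L}$ on $\Lambda$ satisfies the partial Brownian Gibbs property with respect to $\vec{A}$-area tilts if it is non-intersecting and for every finite $K=\{k_1,k_1+1,\dots,k_2\}\subset\Sigma$ with $k_2\le N-1$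 (no restriction if $\Sigma=\mathbb{N}$), every $[a,b]\subset\Lambda$ with $a<b$, and every bounded Borel-measurable $F:C(K\times[a,b])\to\mathbb{R}$, $\mathbb{P}$-almost surely $$\mathbb{E}\big[F(\mathcal{L}|_{K\times[a,b]})\,\big|\,\mathcal{F}_{\mathrm{ext}}(K\times(a,b))\big]=\mathbb{E}_{\mathrm{avoid},\vec{A}_K}^{k_1,k_2,a,b,\vec{x},\vec{y},f,g}[F(\mathcal{Q})],$$ where $\mathcal{F}_{\mathrm{ext}}(K\times(a,b))=\sigma\{\mathcal{L}_i(s):(i,s)\in(\Sigma\times\Lambda)\setminus(K\times(a,b))\}$, $\vec{A}_K=(A_{k_1},\dots,A_{k_2})$, $\vec{x}=(\mathcal{L}_{k_1}(a),\dots,\mathcal{L}_{k_2}(a))$, $\vec{y}=(\mathcal{L}_{k_1}(b),\dots,\mathcal{L}_{k_2}(b))$, $f=\mathcal{L}_{k_1-1}|_{[a,b]}$ (with $f=\infty$ if $k_1-1\notin\Sigma$), $g=\mathcal{L}_{k_2+1}|_{[a,b]}$. The partial Brownian Gibbs property (without area tilts) is this property with $A_i=0$ for all $i\in\Sigma$. *)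

theory Defs
  imports "HOL-Probability.Probability" "HOL-Library.Extended_Nat"
begin

section \<open>Continuous functions on \<open>\<Sigma> \<times> \<Lambda>\<close>\<close>

text \<open>Lines are indexed by integers, and \<open>q (i, s)\<close> is the value of the \<open>i\<close>-th line at \<open>s\<close>.
  A function on \<open>S \<times> T\<close> is represented by its \<^const>\<open>extensional\<close> extension.\<close>

definition ens_space :: "int set \<Rightarrow> real set \<Rightarrow> (int \<times> real \<Rightarrow> real) set" where
  "ens_space S T = {q \<in> extensional (S \<times> T).
     continuous_map (prod_topology (discrete_topology S) (top_of_set T)) euclideanreal q}"

text \<open>The topology of uniform convergence on compact sets. For continuous \<open>p\<close>, \<open>q\<close> and nonempty
  compact \<open>C\<close>, the pointwise bound on \<open>C\<close> says that the supremum of the distance over \<open>C\<close> is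
  less than \<open>\<epsilon>\<close>.\<close>

definition ens_topology :: "int set \<Rightarrow> real set \<Rightarrow> (int \<times> real \<Rightarrow> real) topology" where
  "ens_topology S T = topology_generated_by
     {{p \<in> ens_space S T. \<forall>z\<in>C. dist (p z) (q z) < \<epsilon>} | q C \<epsilon>.
        q \<in> ens_space S T \<and>
        compactin (prod_topology (discrete_topology S) (top_of_set T)) C \<and> 0 < \<epsilon>}"

lemma topspace_ens_topology: "topspace (ens_topology S T) = ens_space S T"
proof (rule subset_antisym)
  show "topspace (ens_topology S T) \<subseteq> ens_space S T"
    unfolding ens_topology_def topology_generated_by_topspace by (rule Union_least) auto
  show "ens_space S T \<subseteq> topspace (ens_topology S T)"
  proof
    fix q assume q: "q \<in> ens_space S T"
    show "q \<in> topspace (ens_topology S T)"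
      unfolding ens_topology_def topology_generated_by_topspace
    proof (rule UnionI)
      show "q \<in> ens_space S T" by (rule q)
      show "ens_space S T \<in> {{p \<in> ens_space S T. \<forall>z\<in>C. dist (p z) (q z) < \<epsilon>} | q C \<epsilon>.
        q \<in> ens_space S T \<and>
        compactin (prod_topology (discrete_topology S) (top_of_set T)) C \<and> 0 < \<epsilon>}"
        using q by (intro CollectI exI[of _ q] exI[of _ "{}"] exI[of _ "1::real"]) simp
    qed
  qed
qed

definition ens_borel :: "int set \<Rightarrow> real set \<Rightarrow> (int \<times> real \<Rightarrow> real) measure" where
  "ens_borel S T = sigma (ens_space S T) {U. openin (ens_topology S T) U}"


section \<open>Line ensembles\<close>

definition line_ensemble ::
  "'w measure \<Rightarrow> int set \<Rightarrow> real set \<Rightarrow> ('w \<Rightarrow> int \<times> real \<Rightarrow> real) \<Rightarrow> bool" where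
  "line_ensemble M S T L \<longleftrightarrow> prob_space M \<and> L \<in> M \<rightarrow>\<^sub>M ens_borel S T"

definition non_intersecting ::
  "'w measure \<Rightarrow> int set \<Rightarrow> real set \<Rightarrow> ('w \<Rightarrow> int \<times> real \<Rightarrow> real) \<Rightarrow> bool" where
  "non_intersecting M S T L \<longleftrightarrow>
     (AE \<omega> in M. \<forall>i\<in>S. \<forall>j\<in>S. i < j \<longrightarrow> (\<forall>r\<in>T. L \<omega> (i, r) > L \<omega> (j, r)))"


section \<open>Brownian bridges and the free law\<close>

definition standard_BM :: "'w measure \<Rightarrow> (real \<Rightarrow> 'w \<Rightarrow> real) \<Rightarrow> bool" where
  "standard_BM M W \<longleftrightarrow>
     prob_space M \<and>
     (\<forall>t\<in>{0..1}. W t \<in> borel_measurable M) \<and>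
     (\<forall>\<omega>\<in>space M. continuous_on {0..1} (\<lambda>t. W t \<omega>)) \<and>
     (AE \<omega> in M. W 0 \<omega> = 0) \<and>
     (\<forall>s t. 0 \<le> s \<and> s < t \<and> t \<le> 1 \<longrightarrow>
        distributed M lborel (\<lambda>\<omega>. W t \<omega> - W s \<omega>) (normal_density 0 (sqrt (t - s)))) \<and>
     (\<forall>(n::nat) \<tau>. (\<forall>i\<le>n. \<tau> i \<in> {0..1}) \<and> (\<forall>i<n. \<tau> i \<le> \<tau> (Suc i)) \<longrightarrow>
        prob_space.indep_vars M (\<lambda>_. borel) (\<lambda>i \<omega>. W (\<tau> (Suc i)) \<omega> - W (\<tau> i) \<omega>) {..<n})"

definition indep_standard_BMs ::
  "'w measure \<Rightarrow> int set \<Rightarrow> (int \<Rightarrow> real \<Rightarrow> 'w \<Rightarrow> real) \<Rightarrow> bool" where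
  "indep_standard_BMs M K W \<longleftrightarrow>
     prob_space M \<and>
     (\<forall>i\<in>K. standard_BM M (W i)) \<and>
     prob_space.indep_vars M (\<lambda>_. PiM {0..1} (\<lambda>_. borel)) (\<lambda>i \<omega>. \<lambda>t\<in>{0..1}. W i t \<omega>) K"

text \<open>The law on \<open>C(K \<times> [0, 1])\<close> of independent standard Brownian motions. It exists and is unique
  for finite \<open>K\<close>; as for \<^const>\<open>RN_deriv\<close>, the choice is totalised by a default value.\<close>

definition is_wiener_law :: "int set \<Rightarrow> (int \<times> real \<Rightarrow> real) measure \<Rightarrow> bool" where
  "is_wiener_law K P \<longleftrightarrow>
     sets P = sets (ens_borel K {0..1}) \<and> indep_standard_BMs P K (\<lambda>i t w. w (i, t))"

definition wiener_law :: "int set \<Rightarrow> (int \<times> real \<Rightarrow> real) measure" where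
  "wiener_law K = (if \<exists>P. is_wiener_law K P then SOME P. is_wiener_law K P
                   else null_measure (ens_borel K {0..1}))"

text \<open>If \<open>W\<close> is a standard Brownian motion, then \<open>W t - t * W 1\<close> is the standard Brownian bridge
  on \<open>[0, 1]\<close>; rescaling it and adding the linear interpolation of the endpoint values gives the
  bridge with diffusion parameter 1 from \<open>x\<close> at time \<open>a\<close> to \<open>y\<close> at time \<open>b\<close>.\<close>

definition bridge_of :: "real \<Rightarrow> real \<Rightarrow> real \<Rightarrow> real \<Rightarrow> (real \<Rightarrow> real) \<Rightarrow> real \<Rightarrow> real" where
  "bridge_of a b x y W r =
     (let t = (r - a) / (b - a)
      in sqrt (b - a) * (W t - t * W 1) + (b - r) / (b - a) * x + (r - a) / (b - a) * y)"

text \<open>Here and below, the vectors \<open>x\<close>, \<open>y\<close> (and the area tilts) are indexed by the lines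
  \<open>k1, \<dots>, k2\<close> themselves: \<open>x i\<close> is the entry number \<open>i - k1 + 1\<close>, so that \<open>B\<^sub>i(a) = x i\<close> and
  \<open>B\<^sub>i(b) = y i\<close>.\<close>

definition free_law ::
  "int \<Rightarrow> int \<Rightarrow> real \<Rightarrow> real \<Rightarrow> (int \<Rightarrow> real) \<Rightarrow> (int \<Rightarrow> real) \<Rightarrow> (int \<times> real \<Rightarrow> real) measure" where
  "free_law k1 k2 a b x y =
     distr (wiener_law {k1..k2}) (ens_borel {k1..k2} {a..b})
       (\<lambda>w. \<lambda>(i, r)\<in>{k1..k2} \<times> {a..b}. bridge_of a b (x i) (y i) (\<lambda>t. w (i, t)) r)"


section \<open>Avoiding and area-tilted laws\<close>

definition avoid_event ::
  "int \<Rightarrow> int \<Rightarrow> real \<Rightarrow> real \<Rightarrow> (real \<Rightarrow> ereal) \<Rightarrow> (real \<Rightarrow> ereal) \<Rightarrow> (int \<times> real \<Rightarrow> real) set" where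
  "avoid_event k1 k2 a b f g =
     {q \<in> ens_space {k1..k2} {a..b}. \<forall>r\<in>{a..b}.
        f r > ereal (q (k1, r)) \<and>
        (\<forall>i\<in>{k1..<k2}. q (i, r) > q (i + 1, r)) \<and>
        ereal (q (k2, r)) > g r}"

definition avoid_law ::
  "int \<Rightarrow> int \<Rightarrow> real \<Rightarrow> real \<Rightarrow> (int \<Rightarrow> real) \<Rightarrow> (int \<Rightarrow> real) \<Rightarrow>
   (real \<Rightarrow> ereal) \<Rightarrow> (real \<Rightarrow> ereal) \<Rightarrow> (int \<times> real \<Rightarrow> real) measure" where
  "avoid_law k1 k2 a b x y f g =
     uniform_measure (free_law k1 k2 a b x y) (avoid_event k1 k2 a b f g)"

text \<open>In the area-tilted law the lower boundary \<open>g\<close> has to be finite, so it is real-valued.\<close>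

definition area_weight ::
  "int \<Rightarrow> int \<Rightarrow> real \<Rightarrow> real \<Rightarrow> (int \<Rightarrow> real) \<Rightarrow> (real \<Rightarrow> real) \<Rightarrow> (int \<times> real \<Rightarrow> real) \<Rightarrow> real" where
  "area_weight k1 k2 a b A g q =
     exp (- (\<Sum>i\<in>{k1..k2}. integral {a..b} (\<lambda>u. A i * (q (i, u) - g u))))"

definition tilted_law ::
  "int \<Rightarrow> int \<Rightarrow> real \<Rightarrow> real \<Rightarrow> (int \<Rightarrow> real) \<Rightarrow> (int \<Rightarrow> real) \<Rightarrow> (int \<Rightarrow> real) \<Rightarrow>
   (real \<Rightarrow> ereal) \<Rightarrow> (real \<Rightarrow> real) \<Rightarrow> (int \<times> real \<Rightarrow> real) measure" where
  "tilted_law k1 k2 a b A x y f g =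
     (let P = avoid_law k1 k2 a b x y f (\<lambda>r. ereal (g r));
          Z = (\<integral>q. area_weight k1 k2 a b A g q \<partial>P)
      in density P (\<lambda>q. ennreal (area_weight k1 k2 a b A g q / Z)))"


section \<open>The partial Brownian Gibbs property\<close>

text \<open>\<open>{1, \<dots>, N}\<close> for finite \<open>N\<close>, and all positive integers for \<open>N = \<infinity>\<close>.\<close>

definition index_set :: "enat \<Rightarrow> int set" where
  "index_set N = {i. 1 \<le> i \<and> enat (nat i) \<le> N}"

definition ext_sigma ::
  "'w measure \<Rightarrow> int set \<Rightarrow> real set \<Rightarrow> ('w \<Rightarrow> int \<times> real \<Rightarrow> real) \<Rightarrow>
   int set \<Rightarrow> real \<Rightarrow> real \<Rightarrow> 'w measure" where
  "ext_sigma M S T L K a b =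
     sigma (space M) {(\<lambda>\<omega>. L \<omega> p) -` B \<inter> space M | p B.
       p \<in> (S \<times> T) - (K \<times> {a<..<b}) \<and> B \<in> sets borel}"

definition tilted_partial_Gibbs ::
  "'w measure \<Rightarrow> enat \<Rightarrow> real set \<Rightarrow> (int \<Rightarrow> real) \<Rightarrow> ('w \<Rightarrow> int \<times> real \<Rightarrow> real) \<Rightarrow> bool" where
  "tilted_partial_Gibbs M N \<Lambda> A L \<longleftrightarrow>
     line_ensemble M (index_set N) \<Lambda> L \<and>
     non_intersecting M (index_set N) \<Lambda> L \<and>
     (\<forall>k1 k2 a b F.
        k1 \<le> k2 \<and> {k1..k2} \<subseteq> index_set N \<and> enat (nat (k2 + 1)) \<le> N \<and>
        a < b \<and> {a..b} \<subseteq> \<Lambda> \<and>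
        F \<in> borel_measurable (ens_borel {k1..k2} {a..b}) \<and>
        bounded (F ` ens_space {k1..k2} {a..b}) \<longrightarrow>
        (AE \<omega> in M.
           real_cond_exp M (ext_sigma M (index_set N) \<Lambda> L {k1..k2} a b)
             (\<lambda>\<omega>. F (restrict (L \<omega>) ({k1..k2} \<times> {a..b}))) \<omega> =
           (\<integral>q. F q \<partial>tilted_law k1 k2 a b A
              (\<lambda>i. L \<omega> (i, a)) (\<lambda>i. L \<omega> (i, b))
              (\<lambda>r. if k1 - 1 \<in> index_set N then ereal (L \<omega> (k1 - 1, r)) else \<infinity>)
              (\<lambda>r. L \<omega> (k2 + 1, r)))))"

definition partial_Gibbs ::
  "'w measure \<Rightarrow> enat \<Rightarrow> real set \<Rightarrow> ('w \<Rightarrow> int \<times> real \<Rightarrow> real) \<Rightarrow> bool" where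
  "partial_Gibbs M N \<Lambda> L \<longleftrightarrow> tilted_partial_Gibbs M N \<Lambda> (\<lambda>_. 0) L"

end

theory Submission
  imports Defs
begin

text \<open>
  Everything comes down to one Gaussian computation. Adding \<open>h(x) = (A/2) x\<^sup>2 + c x + d\<close> to a
  Brownian bridge on \<open>[a, b]\<close> moves its endpoint values by \<open>h(a)\<close> and \<open>h(b)\<close>, and what is left
  over after subtracting the linear interpolation of \<open>h\<close> is the parabola \<open>(A/2)(r - a)(r - b)\<close>,
  which vanishes at both ends. By Cameron and Martin, a bridge shifted by a curve \<open>\<psi>\<close> that vanishes
  at both ends has a density proportional to \<open>exp (\<integral> \<psi>' dB) = exp (- \<integral> \<psi>'' B)\<close> with respect to the
  unshifted bridge. Here \<open>\<psi>'' = A\<close> is constant, so the density is \<open>exp (- A \<integral> B)\<close> up to a constant: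
  exactly the area tilt. This is \<open>free_law_shift\<close>. Since adding \<open>h\<close> to all curves
  respects the order between them, the avoiding event of the original boundary data is
  the preimage of the avoiding event of the shifted data; conditioning and normalising absorb all
  constants, and \<open>tilted_law_add_curve\<close> says that the untilted law, pushed forward by
  \<open>q \<mapsto> q + h\<close>, is the area-tilted law with the shifted boundary data. The two
  ensembles generate the same external \<open>\<sigma>\<close>-algebras, so the Gibbs identity of the shifted ensemble for
  a test function \<open>F\<close> is the Gibbs identity of the original one for \<open>F(\<cdot> + h)\<close>
  (\<open>gibbs_identity_add_curve\<close>), and \<open>F \<mapsto> F(\<cdot> + h)\<close> is a bijection of test functions.

  The Cameron-Martin formula is proved by discretisation. On a grid of mesh \<open>1/n\<close> the increments of a
  Brownian motion are independent Gaussian variables, and shifting them multiplies their law by an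
  explicit exponential (\<open>grid_cameron_martin\<close>). Summation by parts turns the exponent into a
  Riemann sum, so along a fixed path these densities converge to the exponential
  \<open>exp (path_exponent \<alpha> K W \<omega>)\<close>. They are bounded in \<open>L\<^sup>2\<close>, because the square of such a density is a
  bounded multiple of the density for twice the shift; hence the limit has mean one
  (\<open>nn_integral_exp_path_exponent\<close>). Fatou's lemma gives one inequality between the
  two measures on every event that depends on finitely many rational times. As both measures have
  total mass one, the same inequality for the complement turns it into an equality.

  To pass from finitely many times to the path space one needs that the Borel sets of the topology of
  uniform convergence on compact sets are generated by the evaluations at points
  (\<open>measurable_ens_borelI\<close>).
\<close>

section \<open>The Borel sets of the path space\<close>

lemma ens_space_iff:
  "q \<in> ens_space S T \<longleftrightarrow>
     q \<in> extensional (S \<times> T) \<and> (\<forall>i\<in>S. continuous_on T (\<lambda>t. q (i, t)))"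
proof -
  let ?X = "prod_topology (discrete_topology S) (top_of_set T)"
  have "continuous_map ?X euclideanreal q \<longleftrightarrow> (\<forall>i\<in>S. continuous_on T (\<lambda>t. q (i, t)))"
  proof
    assume q: "continuous_map ?X euclideanreal q"
    show "\<forall>i\<in>S. continuous_on T (\<lambda>t. q (i, t))"
    proof
      fix i assume i: "i \<in> S"
      have "continuous_map (top_of_set T) ?X (\<lambda>t. (i, t))"
        using i by (auto simp: continuous_map_paired)
      then have "continuous_map (top_of_set T) euclideanreal (q \<circ> (\<lambda>t. (i, t)))"
        using q by (rule continuous_map_compose)
      then show "continuous_on T (\<lambda>t. q (i, t))"
        by (simp add: o_def)
    qed
  next
    assume q: "\<forall>i\<in>S. continuous_on T (\<lambda>t. q (i, t))"
    show "continuous_map ?X euclideanreal q"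
      unfolding continuous_map_def
    proof (intro conjI allI impI)
      fix U :: "real set" assume U: "openin euclideanreal U"
      have eq: "{x \<in> topspace ?X. q x \<in> U} = (\<Union>i\<in>S. {i} \<times> {t \<in> T. q (i, t) \<in> U})"
        by auto
      have "openin ?X ({i} \<times> {t \<in> T. q (i, t) \<in> U})" if i: "i \<in> S" for i
      proof -
        have "openin (top_of_set T) (T \<inter> (\<lambda>t. q (i, t)) -` U)"
          using q i U by (intro continuous_openin_preimage_gen) auto
        moreover have "T \<inter> (\<lambda>t. q (i, t)) -` U = {t \<in> T. q (i, t) \<in> U}" by auto
        ultimately show ?thesis
          using i by (simp add: openin_prod_Times_iff)
      qed
      then show "openin ?X {x \<in> topspace ?X. q x \<in> U}"
        unfolding eq by (intro openin_Union) auto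
    qed auto
  qed
  then show ?thesis by (simp add: ens_space_def)
qed

lemma space_ens_borel [simp]: "space (ens_borel S T) = ens_space S T"
  using openin_subset[of "ens_topology S T"]
  by (auto simp: ens_borel_def topspace_ens_topology space_measure_of_conv)

lemma sets_ens_borel:
  "sets (ens_borel S T) = sigma_sets (ens_space S T) {U. openin (ens_topology S T) U}"
  unfolding ens_borel_def using openin_subset[of "ens_topology S T"]
  by (intro sets_measure_of) (auto simp: topspace_ens_topology)

lemma openin_ens_ball:
  assumes "q \<in> ens_space S T" "0 < e"
    and "compactin (prod_topology (discrete_topology S) (top_of_set T)) C"
  shows "openin (ens_topology S T) {p \<in> ens_space S T. \<forall>z\<in>C. dist (p z) (q z) < e}"
  unfolding ens_topology_def using assms by (intro topology_generated_by_Basis) blast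

lemma openin_imp_sets_ens_borel: "openin (ens_topology S T) U \<Longrightarrow> U \<in> sets (ens_borel S T)"
  by (auto simp: sets_ens_borel)

text \<open>The half-line below \<open>y\<close> is the union of the balls around \<open>y - n\<close> of radius \<open>n\<close>, and the constant
  functions are available as centres of the corresponding basic open sets.\<close>

lemma measurable_ens_eval:
  assumes "z \<in> S \<times> T" shows "(\<lambda>p. p z) \<in> borel_measurable (ens_borel S T)"
proof (rule borel_measurableI_less)
  fix y :: real
  have o: "openin (ens_topology S T) {p \<in> ens_space S T. dist (p z) (y - real n) < real n}"
    for n :: nat
  proof (cases "n = 0")
    case False
    have c: "(\<lambda>_\<in>S \<times> T. y - real n) \<in> ens_space S T"
      by (auto simp: ens_space_iff intro!: continuous_on_eq[OF continuous_on_const])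
    have "compactin (prod_topology (discrete_topology S) (top_of_set T)) {z}"
      using assms by (auto simp: compactin_sing)
    from openin_ens_ball[OF c _ this, of "real n"] False assms show ?thesis by auto
  qed auto
  have "{p \<in> ens_space S T. p z < y} =
      (\<Union>n::nat. {p \<in> ens_space S T. dist (p z) (y - real n) < real n})"
  proof safe
    fix p assume "p \<in> ens_space S T" "p z < y"
    obtain n :: nat where "real n > \<bar>y - p z\<bar>" using reals_Archimedean2 by blast
    then show "p \<in> (\<Union>n::nat. {p \<in> ens_space S T. dist (p z) (y - real n) < real n})"
      using \<open>p \<in> _\<close> \<open>p z < y\<close> by (auto simp: dist_real_def intro!: exI[of _ n])
  qed (auto simp: dist_real_def)
  also have "\<dots> \<in> sets (ens_borel S T)"
    by (intro openin_imp_sets_ens_borel openin_Union) (use o in auto)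
  finally show "{w \<in> space (ens_borel S T). w z < y} \<in> sets (ens_borel S T)" by simp
qed

text \<open>A tube confines pieces of the lines to bands around given levels. All its data are
  rational, so there are only countably many tubes with a finite list of constraints. No centre
  in the path space is involved, which avoids having to exhibit a countable dense set of paths.\<close>

definition tube ::
  "int set \<Rightarrow> real set \<Rightarrow> (int \<times> rat \<times> rat \<times> rat \<times> rat) set \<Rightarrow> (int \<times> real \<Rightarrow> real) set" where
  "tube S T l = {p \<in> ens_space S T. \<forall>(i, s, t, v, e)\<in>l. i \<in> S \<longrightarrow>
     (\<forall>r \<in> T \<inter> {of_rat s..of_rat t}. \<bar>p (i, r) - of_rat v\<bar> \<le> of_rat e)}"

text \<open>Near each point of the compact set \<open>C\<close>, continuity of \<open>p\<close> and \<open>q\<close> provides a band that contains \<open>p\<close>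
  and whose points are all closer than \<open>\<epsilon>\<close> to \<open>q\<close>. Finitely many of these bands suffice.\<close>

lemma ball_contains_tube:
  assumes q: "q \<in> ens_space S T" and p: "p \<in> ens_space S T"
    and C: "compactin (prod_topology (discrete_topology S) (top_of_set T)) C"
    and e: "\<forall>z\<in>C. dist (p z) (q z) < \<epsilon>"
  shows "\<exists>l. finite l \<and> p \<in> tube S T l \<and> tube S T l \<subseteq> {p \<in> ens_space S T. \<forall>z\<in>C. dist (p z) (q z) < \<epsilon>}"
proof -
  let ?X = "prod_topology (discrete_topology S) (top_of_set T)"
  have CS: "C \<subseteq> S \<times> T" using compactin_subset_topspace[OF C] by simp
  have local: "\<exists>s t v e. of_rat s < snd z \<and> snd z < of_rat t \<and>
      (\<forall>r\<in>T \<inter> {of_rat s..of_rat t}. \<bar>p (fst z, r) - of_rat v\<bar> \<le> of_rat e \<and>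
         \<bar>q (fst z, r) - of_rat v\<bar> + of_rat e < \<epsilon>)" if z: "z \<in> C" for z
  proof -
    obtain i r where ir: "z = (i, r)" by (cases z)
    have i: "i \<in> S" and r: "r \<in> T" using CS z ir by auto
    \<comment> \<open>The gap \<open>8 \<eta>\<close> pays for the oscillations of \<open>p\<close> and \<open>q\<close>, the rounding of the level and the radius.\<close>
    define \<eta> where "\<eta> = (\<epsilon> - \<bar>p z - q z\<bar>) / 8"
    have \<eta>: "\<eta> > 0" using e z by (auto simp: \<eta>_def dist_real_def)
    have pc: "continuous_on T (\<lambda>t. p (i, t))" "continuous_on T (\<lambda>t. q (i, t))"
      using p q i by (auto simp: ens_space_iff)
    obtain d1 where d1: "d1 > 0" "\<And>x. x \<in> T \<Longrightarrow> dist x r < d1 \<Longrightarrow> dist (p (i, x)) (p (i, r)) < \<eta>"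
      using pc(1) r \<eta> unfolding continuous_on_iff by blast
    obtain d2 where d2: "d2 > 0" "\<And>x. x \<in> T \<Longrightarrow> dist x r < d2 \<Longrightarrow> dist (q (i, x)) (q (i, r)) < \<eta>"
      using pc(2) r \<eta> unfolding continuous_on_iff by blast
    define d where "d = min d1 d2"
    have d: "d > 0" using d1 d2 by (simp add: d_def)
    obtain s where s: "r - d < of_rat s" "of_rat s < r"
      using of_rat_dense[of "r - d" r] d by auto
    obtain t where t: "r < of_rat t" "of_rat t < r + d"
      using of_rat_dense[of r "r + d"] d by auto
    obtain v where v: "p z - \<eta> < of_rat v" "of_rat v < p z + \<eta>"
      using of_rat_dense[of "p z - \<eta>" "p z + \<eta>"] \<eta> by auto
    obtain e where e: "2 * \<eta> < of_rat e" "of_rat e < 3 * \<eta>"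
      using of_rat_dense[of "2 * \<eta>" "3 * \<eta>"] \<eta> by auto
    have "\<bar>p (i, x) - of_rat v\<bar> \<le> of_rat e \<and> \<bar>q (i, x) - of_rat v\<bar> + of_rat e < \<epsilon>"
      if x: "x \<in> T" "of_rat s \<le> x" "x \<le> of_rat t" for x
    proof -
      have "dist x r < d" using x s t by (auto simp: dist_real_def)
      then have 1: "\<bar>p (i, x) - p z\<bar> < \<eta>" and 2: "\<bar>q (i, x) - q z\<bar> < \<eta>"
        using d1(2)[of x] d2(2)[of x] x ir by (auto simp: d_def dist_real_def)
      have 3: "\<bar>p z - q z\<bar> = \<epsilon> - 8 * \<eta>" by (simp add: \<eta>_def field_simps)
      have "\<bar>p (i, x) - of_rat v\<bar> < 2 * \<eta>" using 1 v by linarith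
      moreover have "\<bar>q (i, x) - of_rat v\<bar> < \<epsilon> - 6 * \<eta>" using 2 3 v by linarith
      ultimately show ?thesis using e \<eta> by linarith
    qed
    then show ?thesis using s t ir by (intro exI[of _ s] exI[of _ t] exI[of _ v] exI[of _ e]) auto
  qed
  then obtain s t v e where stve: "\<And>z. z \<in> C \<Longrightarrow> of_rat (s z) < snd z \<and> snd z < of_rat (t z) \<and>
      (\<forall>r\<in>T \<inter> {of_rat (s z)..of_rat (t z)}. \<bar>p (fst z, r) - of_rat (v z)\<bar> \<le> of_rat (e z) \<and>
         \<bar>q (fst z, r) - of_rat (v z)\<bar> + of_rat (e z) < \<epsilon>)"
    by metis
  define N where "N z = {fst z} \<times> (T \<inter> {of_rat (s z)<..<of_rat (t z)})" for z
  have "openin ?X (N z)" if "z \<in> C" for z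
    using that CS by (auto simp: N_def openin_prod_Times_iff openin_open_Int)
  moreover have "C \<subseteq> \<Union> (N ` C)"
    using stve CS by (force simp: N_def)
  ultimately obtain F where F: "finite F" "F \<subseteq> N ` C" "C \<subseteq> \<Union> F"
    using C unfolding compactin_def by (metis (no_types, lifting) imageE)
  obtain C0 where C0: "finite C0" "C0 \<subseteq> C" "F = N ` C0"
    using F finite_subset_image by metis
  define l where "l = (\<lambda>z. (fst z, s z, t z, v z, e z)) ` C0"
  have "p \<in> tube S T l" using stve C0 p by (auto simp: tube_def l_def)
  moreover have "dist (p' z) (q z) < \<epsilon>" if p': "p' \<in> tube S T l" and z: "z \<in> C" for p' z
  proof -
    obtain z0 where z0: "z0 \<in> C0" "z \<in> N z0" using z F C0 by auto
    then have zz: "fst z = fst z0" "fst z0 \<in> S" "snd z \<in> T \<inter> {of_rat (s z0)..of_rat (t z0)}"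
      using C0 CS by (auto simp: N_def)
    have "\<bar>p' (fst z0, snd z) - of_rat (v z0)\<bar> \<le> of_rat (e z0)"
      using p' z0 zz unfolding tube_def l_def by auto
    moreover have "\<bar>q (fst z0, snd z) - of_rat (v z0)\<bar> + of_rat (e z0) < \<epsilon>"
      using stve[of z0] zz z0 C0 by auto
    moreover have "z = (fst z0, snd z)" using zz(1) by (metis prod.collapse)
    ultimately have "\<bar>p' z - of_rat (v z0)\<bar> \<le> of_rat (e z0)"
      "\<bar>q z - of_rat (v z0)\<bar> + of_rat (e z0) < \<epsilon>" by metis+
    then show ?thesis unfolding dist_real_def by linarith
  qed
  ultimately show ?thesis using C0(1)
    by (intro exI[of _ l]) (auto simp: l_def tube_def)
qed

lemma open_contains_tube:
  assumes "openin (ens_topology S T) U" "p \<in> U"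
  shows "\<exists>l. finite l \<and> p \<in> tube S T l \<and> tube S T l \<subseteq> U"
proof -
  have "generate_topology_on {{p \<in> ens_space S T. \<forall>z\<in>C. dist (p z) (q z) < \<epsilon>} | q C \<epsilon>.
        q \<in> ens_space S T \<and>
        compactin (prod_topology (discrete_topology S) (top_of_set T)) C \<and> 0 < \<epsilon>} U"
    using assms(1) by (simp add: ens_topology_def openin_topology_generated_by_iff)
  then show ?thesis using assms(2)
  proof (induction U arbitrary: p)
    case (Int a b)
    then obtain l1 l2 where "finite l1" "p \<in> tube S T l1" "tube S T l1 \<subseteq> a"
      "finite l2" "p \<in> tube S T l2" "tube S T l2 \<subseteq> b" by blast
    moreover have "tube S T (l1 \<union> l2) = tube S T l1 \<inter> tube S T l2"
      unfolding tube_def ball_Un by blast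
    ultimately show ?case
      by (intro exI[of _ "l1 \<union> l2"]) blast
  next
    case (UN K)
    then show ?case by (meson UnionE Union_upper subset_trans)
  next
    case (Basis s)
    then show ?case using ball_contains_tube by blast
  qed auto
qed

text \<open>By continuity, a countable dense set of times decides the condition.\<close>

lemma sets_Collect_ball_le:
  fixes u :: "'a \<Rightarrow> real \<Rightarrow> real"
  assumes cont: "\<And>x. x \<in> space N \<Longrightarrow> continuous_on I (u x)"
    and meas: "\<And>r. r \<in> I \<Longrightarrow> (\<lambda>x. u x r) \<in> borel_measurable N"
  shows "{x \<in> space N. \<forall>r\<in>I. u x r \<le> e} \<in> sets N"
proof -
  obtain D where D: "countable D" "D \<subseteq> I" "I \<subseteq> closure D"
    using separable[of I] by blast
  have "u x r \<le> e" if x: "x \<in> space N" and *: "\<forall>r\<in>D. u x r \<le> e" and r: "r \<in> I" for x r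
  proof -
    have "r \<in> closure D" using D r by auto
    then obtain v where v: "\<And>n. v n \<in> D" "v \<longlonglongrightarrow> r"
      unfolding closure_sequential by blast
    have "(\<lambda>n. u x (v n)) \<longlonglongrightarrow> u x r"
      by (intro continuous_on_tendsto_compose[OF cont[OF x] v(2) r] always_eventually)
         (use v(1) D(2) in blast)
    then show ?thesis
      by (rule LIMSEQ_le_const2) (use * v in auto)
  qed
  then have "{x \<in> space N. \<forall>r\<in>I. u x r \<le> e} = {x \<in> space N. \<forall>r\<in>D. u x r \<le> e}"
    using D(2) by blast
  also have "\<dots> = space N - (\<Union>r\<in>D. {x \<in> space N. \<not> u x r \<le> e})"
    by blast
  also have "\<dots> \<in> sets N"
  proof (intro sets.Diff sets.top sets.countable_UN' D(1) image_subsetI)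
    fix r assume "r \<in> D"
    then have [measurable]: "(\<lambda>x. u x r) \<in> borel_measurable N"
      using D(2) by (intro meas) auto
    show "{x \<in> space N. \<not> u x r \<le> e} \<in> sets N"
      by measurable
  qed
  finally show ?thesis .
qed

text \<open>By compactness, positivity on the interval comes with a positive lower bound \<open>1 / (n + 1)\<close>.\<close>

lemma sets_Collect_ball_pos:
  fixes u :: "'a \<Rightarrow> real \<Rightarrow> real"
  assumes cont: "\<And>x. x \<in> space N \<Longrightarrow> continuous_on {a..b} (u x)"
    and meas: "\<And>r. r \<in> {a..b} \<Longrightarrow> (\<lambda>x. u x r) \<in> borel_measurable N"
  shows "{x \<in> space N. \<forall>r\<in>{a..b}. 0 < u x r} \<in> sets N"
proof -
  have gap: "\<exists>n. \<forall>r\<in>{a..b}. - u x r \<le> - inverse (real (Suc n))"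
    if x: "x \<in> space N" and pos: "\<forall>r\<in>{a..b}. 0 < u x r" for x
  proof (cases "{a..b} = {}")
    case False
    then obtain r0 where r0: "r0 \<in> {a..b}" "\<And>r. r \<in> {a..b} \<Longrightarrow> u x r0 \<le> u x r"
      using continuous_attains_inf[OF compact_Icc _ cont[OF x]] by blast
    obtain n where "inverse (real (Suc n)) < u x r0"
      using reals_Archimedean[of "u x r0"] pos r0(1) by blast
    then show ?thesis using r0(2) by (intro exI[of _ n]) force
  qed simp
  have pos: "0 < u x r" if "- u x r \<le> - inverse (real (Suc n))" for x r n
    using that by (smt (verit) inverse_positive_iff_positive of_nat_0_less_iff zero_less_Suc)
  have "{x \<in> space N. \<forall>r\<in>{a..b}. 0 < u x r} =
      (\<Union>n. {x \<in> space N. \<forall>r\<in>{a..b}. - u x r \<le> - inverse (real (Suc n))})"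
  proof (intro set_eqI iffI)
    fix x assume "x \<in> {x \<in> space N. \<forall>r\<in>{a..b}. 0 < u x r}"
    then show "x \<in> (\<Union>n. {x \<in> space N. \<forall>r\<in>{a..b}. - u x r \<le> - inverse (real (Suc n))})"
      using gap[of x] by auto
  next
    fix x assume "x \<in> (\<Union>n. {x \<in> space N. \<forall>r\<in>{a..b}. - u x r \<le> - inverse (real (Suc n))})"
    then obtain n where "x \<in> space N" "\<forall>r\<in>{a..b}. - u x r \<le> - inverse (real (Suc n))"
      by blast
    then show "x \<in> {x \<in> space N. \<forall>r\<in>{a..b}. 0 < u x r}"
      using pos[of x _ n] by blast
  qed
  also have "\<dots> \<in> sets N"
  proof (rule sets.countable_UN''[OF countableI_type], rule sets_Collect_ball_le)
    show "continuous_on {a..b} (\<lambda>r. - u x r)" if "x \<in> space N" for x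
      by (intro continuous_on_minus cont that)
    show "(\<lambda>x. - u x r) \<in> borel_measurable N" if "r \<in> {a..b}" for r
      by (intro borel_measurable_uminus meas that)
  qed
  finally show ?thesis .
qed

text \<open>Every open set is a countable union of tubes, and each tube is cut out by countably many
  conditions on evaluations.\<close>

lemma measurable_ens_borelI:
  assumes f: "\<And>x. x \<in> space N \<Longrightarrow> f x \<in> ens_space S T"
    and ev: "\<And>z. z \<in> S \<times> T \<Longrightarrow> (\<lambda>x. f x z) \<in> borel_measurable N"
  shows "f \<in> N \<rightarrow>\<^sub>M ens_borel S T"
proof -
  have tube: "f -` tube S T l \<inter> space N \<in> sets N" if l: "finite l" for l
  proof -
    have "{x \<in> space N. case y of (i, s, t, v, e) \<Rightarrow> i \<in> S \<longrightarrow>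
        (\<forall>r \<in> T \<inter> {of_rat s..of_rat t}. \<bar>f x (i, r) - of_rat v\<bar> \<le> of_rat e)} \<in> sets N" for y
    proof -
      obtain i s t v e where y: "y = (i, s, t, v, e)" by (cases y)
      show ?thesis
      proof (cases "i \<in> S")
        case True
        have "{x \<in> space N. \<forall>r \<in> T \<inter> {of_rat s..of_rat t}. \<bar>f x (i, r) - of_rat v\<bar> \<le> of_rat e} \<in> sets N"
        proof (rule sets_Collect_ball_le)
          fix x assume "x \<in> space N"
          then show "continuous_on (T \<inter> {of_rat s..of_rat t}) (\<lambda>r. \<bar>f x (i, r) - of_rat v\<bar>)"
            using f[of x] True
            by (intro continuous_intros) (auto simp: ens_space_iff intro: continuous_on_subset)
        next
          fix r assume "r \<in> T \<inter> {of_rat s..of_rat t}"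
          then have [measurable]: "(\<lambda>x. f x (i, r)) \<in> borel_measurable N"
            using True by (intro ev) auto
          show "(\<lambda>x. \<bar>f x (i, r) - of_rat v\<bar>) \<in> borel_measurable N" by measurable
        qed
        then show ?thesis using True by (simp add: y)
      qed (simp add: y)
    qed
    then have "{x \<in> space N. \<forall>y\<in>l. case y of (i, s, t, v, e) \<Rightarrow> i \<in> S \<longrightarrow>
        (\<forall>r \<in> T \<inter> {of_rat s..of_rat t}. \<bar>f x (i, r) - of_rat v\<bar> \<le> of_rat e)} \<in> sets N"
      unfolding pred_def[symmetric] using l
      by (intro pred_intros_finite(3)) auto
    also have "{x \<in> space N. \<forall>y\<in>l. case y of (i, s, t, v, e) \<Rightarrow> i \<in> S \<longrightarrow>
        (\<forall>r \<in> T \<inter> {of_rat s..of_rat t}. \<bar>f x (i, r) - of_rat v\<bar> \<le> of_rat e)} =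
        f -` tube S T l \<inter> space N"
      using f by (auto simp: tube_def)
    finally show ?thesis .
  qed
  show ?thesis
    unfolding ens_borel_def
  proof (rule measurable_measure_of)
    fix U assume "U \<in> {U. openin (ens_topology S T) U}"
    then have U: "openin (ens_topology S T) U" by simp
    let ?L = "{l. finite l \<and> tube S T l \<subseteq> U}"
    have "U = (\<Union>l\<in>?L. tube S T l)"
      using open_contains_tube[OF U] by blast
    then have "f -` U \<inter> space N = (\<Union>l\<in>?L. f -` tube S T l \<inter> space N)" by blast
    also have "\<dots> \<in> sets N"
      using tube by (intro sets.countable_UN' countable_subset[OF _ countable_Collect_finite]) auto
    finally show "f -` U \<inter> space N \<in> sets N" .
  qed (use f openin_subset[of "ens_topology S T"] in \<open>auto simp: topspace_ens_topology\<close>)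
qed


section \<open>Riemann sums\<close>

text \<open>This serves twice: it identifies the limit of the discrete Cameron-Martin densities, and it shows
  that area integrals are measurable functions of the path.\<close>

lemma right_riemann_sums_tendsto_integral:
  fixes f :: "real \<Rightarrow> real"
  assumes ab: "a \<le> b" and f: "continuous_on {a..b} f"
  shows "(\<lambda>n. (b - a) / real n * (\<Sum>j<n. f (a + (b - a) * real (Suc j) / real n)))
           \<longlonglongrightarrow> integral {a..b} f"
proof (rule LIMSEQ_I)
  fix r :: real assume r: "0 < r"
  define e where "e = r / 2 / (b - a + 1)"
  have e: "e > 0" using r ab by (simp add: e_def)
  have "uniformly_continuous_on {a..b} f"
    using f by (intro compact_uniformly_continuous) auto
  then obtain d where d: "d > 0"
    "\<And>x x'. x \<in> {a..b} \<Longrightarrow> x' \<in> {a..b} \<Longrightarrow> dist x' x < d \<Longrightarrow> dist (f x') (f x) < e"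
    using e unfolding uniformly_continuous_on_def by blast
  obtain n0 :: nat where n0: "real n0 > (b - a) / d" using reals_Archimedean2 by blast
  show "\<exists>no. \<forall>n\<ge>no. norm ((b - a) / real n * (\<Sum>j<n. f (a + (b - a) * real (Suc j) / real n))
      - integral {a..b} f) < r"
  proof (intro exI[of _ "Suc n0"] allI impI)
    fix n assume n: "n \<ge> Suc n0"
    define t where "t j = a + (b - a) * real j / real n" for j
    have npos: "real n > 0" using n by simp
    have step: "t (Suc j) - t j = (b - a) / real n" for j
      by (simp add: t_def add_divide_distrib diff_divide_distrib algebra_simps)
    have mesh: "(b - a) / real n < d"
    proof -
      have "(b - a) / d < real n" using n0 n by linarith
      then show ?thesis using d npos by (simp add: field_simps)
    qed
    have "0 \<le> (b - a) / real n" using ab by simp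
    then have mono: "t j \<le> t (Suc j)" "a \<le> t j" for j
      using step[of j] ab by (linarith, simp add: t_def)
    have tb: "t j \<le> b" if "j \<le> n" for j
    proof -
      have "(b - a) * real j \<le> (b - a) * real n" using ab that by (intro mult_left_mono) auto
      then show ?thesis using npos by (simp add: t_def field_simps)
    qed
    have cell: "\<bar>integral {t j..t (Suc j)} f - (b - a) / real n * f (t (Suc j))\<bar>
        \<le> e * ((b - a) / real n)" if j: "j < n" for j
    proof -
      have sub: "{t j..t (Suc j)} \<subseteq> {a..b}" using mono[of j] tb[of "Suc j"] j by auto
      have c: "continuous_on {t j..t (Suc j)} f" using f sub continuous_on_subset by blast
      have "integral {t j..t (Suc j)} (\<lambda>x. f x - f (t (Suc j)))
          = integral {t j..t (Suc j)} f - (b - a) / real n * f (t (Suc j))"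
        using c mono(1)[of j] step[of j]
        by (subst Henstock_Kurzweil_Integration.integral_diff)
           (auto intro: integrable_continuous_real)
      moreover have "norm (integral {t j..t (Suc j)} (\<lambda>x. f x - f (t (Suc j))))
          \<le> e * (t (Suc j) - t j)"
      proof (rule integral_bound)
        show "t j \<le> t (Suc j)" by (rule mono)
        show "continuous_on {t j..t (Suc j)} (\<lambda>x. f x - f (t (Suc j)))"
          using c by (intro continuous_intros)
        fix x assume x: "x \<in> {t j..t (Suc j)}"
        have "dist x (t (Suc j)) < d" using x step[of j] mesh by (auto simp: dist_real_def)
        then have "dist (f x) (f (t (Suc j))) < e" using x sub mono(1)[of j] by (intro d(2)) auto
        then show "norm (f x - f (t (Suc j))) \<le> e" by (simp add: dist_real_def)
      qed
      ultimately show ?thesis using step by simp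
    qed
    have "m \<le> n \<Longrightarrow> \<bar>integral {a..t m} f - (b - a) / real n * (\<Sum>j<m. f (t (Suc j)))\<bar>
        \<le> e * ((b - a) / real n) * real m" for m
    proof (induction m)
      case 0
      then show ?case by (simp add: t_def)
    next
      case (Suc m)
      have "f integrable_on {a..t (Suc m)}"
        using f tb[OF Suc.prems] continuous_on_subset[of "{a..b}" f "{a..t (Suc m)}"]
        by (intro integrable_continuous_real) auto
      then have "integral {a..t (Suc m)} f = integral {a..t m} f + integral {t m..t (Suc m)} f"
        using mono by (intro Henstock_Kurzweil_Integration.integral_combine[symmetric]) auto
      moreover have "(b - a) / real n * (\<Sum>j<Suc m. f (t (Suc j))) =
          (b - a) / real n * (\<Sum>j<m. f (t (Suc j))) + (b - a) / real n * f (t (Suc m))"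
        by (simp only: sum.lessThan_Suc distrib_left)
      moreover have "e * ((b - a) / real n) * real (Suc m) =
          e * ((b - a) / real n) + e * ((b - a) / real n) * real m"
        by (simp only: of_nat_Suc distrib_left mult_1_right)
      ultimately show ?case using Suc cell[of m] by linarith
    qed
    from this[of n] have "\<bar>integral {a..t n} f - (b - a) / real n * (\<Sum>j<n. f (t (Suc j)))\<bar>
        \<le> e * (b - a)"
      using npos by simp
    also have "t n = b" using npos by (simp add: t_def)
    also have "e * (b - a) < r"
    proof -
      have "e * (b - a) \<le> e * (b - a + 1)" using e by simp
      also have "\<dots> = r / 2"
        unfolding e_def using ab by (intro nonzero_eq_divide_eq[THEN iffD1, OF _ refl]) simp
      also have "\<dots> < r" using r by simp
      finally show ?thesis .
    qed
    finally show "norm ((b - a) / real n * (\<Sum>j<n. f (a + (b - a) * real (Suc j) / real n))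
        - integral {a..b} f) < r"
      by (simp add: t_def abs_minus_commute)
  qed
qed


section \<open>Shifting independent Gaussian variables\<close>

text \<open>A change of variables in each factor of a finite product of probability spaces multiplies the
  densities. Both sides are the product of the transformed factors.\<close>

lemma PiM_map_eq_density:
  assumes I: "finite I" and prob: "\<And>i. prob_space (\<mu> i)"
    and T [measurable]: "\<And>i. T i \<in> \<mu> i \<rightarrow>\<^sub>M \<mu> i"
    and D [measurable]: "\<And>i. D i \<in> borel_measurable (\<mu> i)"
    and eq: "\<And>i. distr (\<mu> i) (\<mu> i) (T i) = density (\<mu> i) (D i)"
  shows "distr (PiM I \<mu>) (PiM I \<mu>) (\<lambda>x. \<lambda>i\<in>I. T i (x i)) =
         density (PiM I \<mu>) (\<lambda>x. \<Prod>i\<in>I. D i (x i))"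
proof -
  define \<nu> where "\<nu> i = density (\<mu> i) (D i)" for i
  interpret \<mu>: product_prob_space \<mu> by (rule product_prob_spaceI) (rule prob)
  have prob': "prob_space (\<nu> i)" for i
    unfolding \<nu>_def eq[symmetric] by (intro prob_space.prob_space_distr prob T)
  interpret \<nu>: product_prob_space \<nu> by (rule product_prob_spaceI) (rule prob')
  have sets_\<nu> [measurable_cong]: "sets (\<nu> i) = sets (\<mu> i)" for i by (simp add: \<nu>_def)
  have sets_PiM_\<nu>: "sets (PiM I \<nu>) = sets (PiM I \<mu>)"
    by (intro sets_PiM_cong) (auto simp: sets_\<nu>)
  have 1: "distr (PiM I \<mu>) (PiM I \<mu>) (\<lambda>x. \<lambda>i\<in>I. T i (x i)) = PiM I \<nu>"
  proof (rule \<nu>.PiM_eqI)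
    fix A assume A: "\<And>i. i \<in> I \<Longrightarrow> A i \<in> sets (\<nu> i)"
    have "emeasure (distr (PiM I \<mu>) (PiM I \<mu>) (\<lambda>x. \<lambda>i\<in>I. T i (x i))) (Pi\<^sub>E I A) =
        emeasure (PiM I \<mu>) ((\<lambda>x. \<lambda>i\<in>I. T i (x i)) -` Pi\<^sub>E I A \<inter> space (PiM I \<mu>))"
      using A I by (intro emeasure_distr sets_PiM_I_finite) (auto simp: sets_\<nu>)
    also have "(\<lambda>x. \<lambda>i\<in>I. T i (x i)) -` Pi\<^sub>E I A \<inter> space (PiM I \<mu>) =
        Pi\<^sub>E I (\<lambda>i. T i -` A i \<inter> space (\<mu> i))"
      by (auto simp: space_PiM PiE_iff extensional_def)
    also have "emeasure (PiM I \<mu>) \<dots> = (\<Prod>i\<in>I. emeasure (\<mu> i) (T i -` A i \<inter> space (\<mu> i)))"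
      using A I by (intro \<mu>.emeasure_PiM measurable_sets[OF T]) (auto simp: sets_\<nu>)
    also have "\<dots> = (\<Prod>i\<in>I. emeasure (\<nu> i) (A i))"
      using A by (intro prod.cong refl) (simp add: \<nu>_def eq[symmetric] emeasure_distr)
    finally show "emeasure (distr (PiM I \<mu>) (PiM I \<mu>) (\<lambda>x. \<lambda>i\<in>I. T i (x i))) (Pi\<^sub>E I A) =
      (\<Prod>i\<in>I. emeasure (\<nu> i) (A i))" .
  qed (auto simp: I sets_PiM_\<nu>)
  have 2: "density (PiM I \<mu>) (\<lambda>x. \<Prod>i\<in>I. D i (x i)) = PiM I \<nu>"
  proof (rule \<nu>.PiM_eqI)
    fix A assume A: "\<And>i. i \<in> I \<Longrightarrow> A i \<in> sets (\<nu> i)"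
    have [measurable]: "Pi\<^sub>E I A \<in> sets (PiM I \<mu>)"
      using A I by (intro sets_PiM_I_finite) (auto simp: sets_\<nu>)
    have "emeasure (density (PiM I \<mu>) (\<lambda>x. \<Prod>i\<in>I. D i (x i))) (Pi\<^sub>E I A) =
        (\<integral>\<^sup>+x. (\<Prod>i\<in>I. D i (x i)) * indicator (Pi\<^sub>E I A) x \<partial>PiM I \<mu>)"
      by (intro emeasure_density) measurable
    also have "\<dots> = (\<integral>\<^sup>+x. (\<Prod>i\<in>I. D i (x i) * indicator (A i) (x i)) \<partial>PiM I \<mu>)"
    proof (intro nn_integral_cong)
      fix x assume x: "x \<in> space (PiM I \<mu>)"
      have "indicator (Pi\<^sub>E I A) x = (\<Prod>i\<in>I. indicator (A i) (x i) :: ennreal)"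
        using x I by (auto simp: indicator_def space_PiM PiE_iff)
      then show "(\<Prod>i\<in>I. D i (x i)) * indicator (Pi\<^sub>E I A) x =
          (\<Prod>i\<in>I. D i (x i) * indicator (A i) (x i))"
        by (simp add: prod.distrib)
    qed
    also have "\<dots> = (\<Prod>i\<in>I. \<integral>\<^sup>+x. D i x * indicator (A i) x \<partial>\<mu> i)"
      using A I by (intro \<mu>.product_nn_integral_prod) (auto simp: sets_\<nu>)
    also have "\<dots> = (\<Prod>i\<in>I. emeasure (\<nu> i) (A i))"
      using A by (intro prod.cong refl) (simp add: \<nu>_def emeasure_density)
    finally show "emeasure (density (PiM I \<mu>) (\<lambda>x. \<Prod>i\<in>I. D i (x i))) (Pi\<^sub>E I A) =
      (\<Prod>i\<in>I. emeasure (\<nu> i) (A i))" .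
  qed (auto simp: I sets_PiM_\<nu>)
  show ?thesis unfolding 1 2 ..
qed

abbreviation gauss :: "real \<Rightarrow> real measure" where
  "gauss v \<equiv> density lborel (normal_density 0 (sqrt v))"

text \<open>This is the one-dimensional Cameron-Martin formula: complete the square in
  \<open>- (x - \<delta>)\<^sup>2 / (2 v)\<close>.\<close>

lemma gauss_shift:
  assumes v: "0 < v"
  shows "distr (gauss v) (gauss v) (\<lambda>x. x + \<delta>) =
         density (gauss v) (\<lambda>x. ennreal (exp (x * \<delta> / v - \<delta>\<^sup>2 / (2 * v))))"
proof (rule measure_eqI)
  fix B assume "B \<in> sets (distr (gauss v) (gauss v) (\<lambda>x. x + \<delta>))"
  then have [measurable]: "B \<in> sets borel" by simp
  have "(\<lambda>x. x + \<delta>) \<in> borel_measurable borel" by measurable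
  then have [measurable]: "(\<lambda>x. x + \<delta>) -` B \<in> sets borel"
    by (rule measurable_sets_borel) fact
  have "emeasure (distr (gauss v) (gauss v) (\<lambda>x. x + \<delta>)) B =
      emeasure (gauss v) ((\<lambda>x. x + \<delta>) -` B \<inter> space (gauss v))"
    by (intro emeasure_distr) auto
  also have "\<dots> = (\<integral>\<^sup>+x. ennreal (normal_density 0 (sqrt v) x) * indicator B (x + \<delta>) \<partial>lborel)"
    by (subst emeasure_density) (auto intro!: nn_integral_cong simp: indicator_def)
  also have "\<dots> = (\<integral>\<^sup>+x. ennreal (normal_density 0 (sqrt v) (x - \<delta>)) * indicator B x \<partial>lborel)"
    by (subst nn_integral_real_affine[where c=1 and t="- \<delta>"]) (auto simp: algebra_simps)
  also have "\<dots> = (\<integral>\<^sup>+x. ennreal (normal_density 0 (sqrt v) x) *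
      (ennreal (exp (x * \<delta> / v - \<delta>\<^sup>2 / (2 * v))) * indicator B x) \<partial>lborel)"
  proof (intro nn_integral_cong)
    fix x
    have "- (x - \<delta>)\<^sup>2 / (2 * v) = - x\<^sup>2 / (2 * v) + (x * \<delta> / v - \<delta>\<^sup>2 / (2 * v))"
      using v by (simp add: field_simps power2_eq_square)
    then have "normal_density 0 (sqrt v) (x - \<delta>) =
        normal_density 0 (sqrt v) x * exp (x * \<delta> / v - \<delta>\<^sup>2 / (2 * v))"
      using v by (simp add: normal_density_def exp_add[symmetric])
    then show "ennreal (normal_density 0 (sqrt v) (x - \<delta>)) * indicator B x =
      ennreal (normal_density 0 (sqrt v) x) *
      (ennreal (exp (x * \<delta> / v - \<delta>\<^sup>2 / (2 * v))) * indicator B x)"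
      by (simp add: ennreal_mult mult.assoc)
  qed
  also have "\<dots> = emeasure (density (gauss v) (\<lambda>x. ennreal (exp (x * \<delta> / v - \<delta>\<^sup>2 / (2 * v))))) B"
    by (simp add: emeasure_density nn_integral_density)
  finally show "emeasure (distr (gauss v) (gauss v) (\<lambda>x. x + \<delta>)) B =
    emeasure (density (gauss v) (\<lambda>x. ennreal (exp (x * \<delta> / v - \<delta>\<^sup>2 / (2 * v))))) B" .
qed simp


section \<open>Shifting a Brownian motion by a parabola\<close>

text \<open>The parabola with second derivative \<open>\<alpha>\<close> that vanishes at 0 and 1, so that adding it to a
  Brownian motion shifts the associated bridge by the same curve.\<close>

definition parabola :: "real \<Rightarrow> real \<Rightarrow> real" where
  "parabola \<alpha> t = \<alpha> / 2 * t * (t - 1)"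

definition increments ::
  "int set \<Rightarrow> (int \<Rightarrow> real \<Rightarrow> 'w \<Rightarrow> real) \<Rightarrow> nat \<Rightarrow> 'w \<Rightarrow> int \<times> nat \<Rightarrow> real" where
  "increments K W n \<omega> =
     (\<lambda>(i, j)\<in>K \<times> {..<n}. W i (real (Suc j) / real n) \<omega> - W i (real j / real n) \<omega>)"

definition parabola_increment :: "real \<Rightarrow> nat \<Rightarrow> nat \<Rightarrow> real" where
  "parabola_increment \<alpha> n j =
     parabola \<alpha> (real (Suc j) / real n) - parabola \<alpha> (real j / real n)"

text \<open>The logarithm of the density that shifts the \<open>n\<close> grid increments, which have variance
  \<open>1 / n\<close>, of every line by those of the parabola.\<close>

definition grid_exponent ::
  "real \<Rightarrow> int set \<Rightarrow> (int \<Rightarrow> real \<Rightarrow> 'w \<Rightarrow> real) \<Rightarrow> nat \<Rightarrow> 'w \<Rightarrow> real" where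
  "grid_exponent \<alpha> K W n \<omega> =
     (\<Sum>z\<in>K \<times> {..<n}. real n * increments K W n \<omega> z * parabola_increment \<alpha> n (snd z)
        - real n * (parabola_increment \<alpha> n (snd z))\<^sup>2 / 2)"

text \<open>The limit of the exponents on grids. If \<open>W 0 = 0\<close>, then the bracket is minus the area under the
  bridge \<open>W t - t * W 1\<close>; the constant \<open>\<alpha>\<^sup>2 / 24\<close> is half the integral of the squared
  derivative of the parabola.\<close>

definition path_exponent ::
  "real \<Rightarrow> int set \<Rightarrow> (int \<Rightarrow> real \<Rightarrow> 'w \<Rightarrow> real) \<Rightarrow> 'w \<Rightarrow> real" where
  "path_exponent \<alpha> K W \<omega> =
     (\<Sum>i\<in>K. \<alpha> * ((W i 1 \<omega> + W i 0 \<omega>) / 2 - integral {0..1} (\<lambda>t. W i t \<omega>)) - \<alpha>\<^sup>2 / 24)"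

lemma sum_parabola_increment_squared:
  assumes "n > 0"
  shows "(\<Sum>j<n. real n * (parabola_increment \<alpha> n j)\<^sup>2) = \<alpha>\<^sup>2 / 12 * (1 - 1 / (real n)\<^sup>2)"
proof -
  have pi: "parabola_increment \<alpha> n j = \<alpha> / (2 * (real n)\<^sup>2) * (2 * real j + 1 - real n)" for j
    using assms by (simp add: parabola_increment_def parabola_def field_simps power2_eq_square)
  have sq: "(\<Sum>j<m. (2 * real j + 1 - x)\<^sup>2) = real m * (4 * (real m)\<^sup>2 - 1) / 3 - 2 * x * (real m)\<^sup>2 + real m * x\<^sup>2"
    for m :: nat and x :: real
    by (induction m) (simp_all add: field_simps power2_eq_square)
  have "(\<Sum>j<n. real n * (parabola_increment \<alpha> n j)\<^sup>2) =
      real n * (\<alpha> / (2 * (real n)\<^sup>2))\<^sup>2 * (\<Sum>j<n. (2 * real j + 1 - real n)\<^sup>2)"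
    by (simp only: pi power_mult_distrib sum_distrib_left mult.assoc)
  also have "\<dots> = \<alpha>\<^sup>2 / 12 * (1 - 1 / (real n)\<^sup>2)"
    unfolding sq using assms by (simp add: field_simps power2_eq_square)
  finally show ?thesis .
qed

text \<open>Summation by parts moves the increment from the path to the parabola. The increments of the
  parabola grow linearly in \<open>j\<close>, so what remains is a Riemann sum of the path and boundary terms.\<close>

lemma sum_increments_parabola:
  fixes w :: "nat \<Rightarrow> real"
  assumes "n > 0"
  shows "(\<Sum>j<n. real n * (w (Suc j) - w j) * parabola_increment \<alpha> n j) =
    \<alpha> * ((w n + w 0) / 2 + (w n - w 0) / (2 * real n) - (\<Sum>j<n. w (Suc j)) / real n)"
proof -
  have pi: "real n * parabola_increment \<alpha> n j = \<alpha> / (2 * real n) * (2 * real j + 1 - real n)" for j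
    using assms by (simp add: parabola_increment_def parabola_def field_simps power2_eq_square)
  have abel: "(\<Sum>j<m. (w (Suc j) - w j) * (2 * real j + 1 - x)) =
      w m * (2 * real m + 1 - x) - w 0 * (1 - x) - 2 * (\<Sum>j<m. w (Suc j))" for m and x :: real
    by (induction m) (simp_all add: algebra_simps)
  have "(\<Sum>j<n. real n * (w (Suc j) - w j) * parabola_increment \<alpha> n j) =
      \<alpha> / (2 * real n) * (\<Sum>j<n. (w (Suc j) - w j) * (2 * real j + 1 - real n))"
    unfolding sum_distrib_left
  proof (intro sum.cong refl)
    fix j
    have "real n * (w (Suc j) - w j) * parabola_increment \<alpha> n j =
        (w (Suc j) - w j) * (real n * parabola_increment \<alpha> n j)" by simp
    then show "real n * (w (Suc j) - w j) * parabola_increment \<alpha> n j =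
        \<alpha> / (2 * real n) * ((w (Suc j) - w j) * (2 * real j + 1 - real n))"
      unfolding pi by simp
  qed
  also have "\<dots> = \<alpha> * ((w n + w 0) / 2 + (w n - w 0) / (2 * real n) - (\<Sum>j<n. w (Suc j)) / real n)"
    unfolding abel using assms by (simp add: field_simps)
  finally show ?thesis .
qed

lemma grid_exponent_eq:
  assumes "n > 0"
  shows "grid_exponent \<alpha> K W n \<omega> =
    (\<Sum>i\<in>K. \<alpha> * ((W i 1 \<omega> + W i 0 \<omega>) / 2 + (W i 1 \<omega> - W i 0 \<omega>) / (2 * real n)
        - (\<Sum>j<n. W i (real (Suc j) / real n) \<omega>) / real n)
       - \<alpha>\<^sup>2 / 24 * (1 - 1 / (real n)\<^sup>2))"
proof -
  have "grid_exponent \<alpha> K W n \<omega> = (\<Sum>i\<in>K. \<Sum>j<n.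
      real n * (W i (real (Suc j) / real n) \<omega> - W i (real j / real n) \<omega>) * parabola_increment \<alpha> n j
        - real n * (parabola_increment \<alpha> n j)\<^sup>2 / 2)"
    unfolding grid_exponent_def sum.cartesian_product
    by (intro sum.cong) (auto simp: increments_def)
  also have "\<dots> = (\<Sum>i\<in>K. \<alpha> * ((W i 1 \<omega> + W i 0 \<omega>) / 2 + (W i 1 \<omega> - W i 0 \<omega>) / (2 * real n)
        - (\<Sum>j<n. W i (real (Suc j) / real n) \<omega>) / real n)
       - \<alpha>\<^sup>2 / 24 * (1 - 1 / (real n)\<^sup>2))"
  proof (intro sum.cong refl)
    fix i
    have "(\<Sum>j<n. real n * (parabola_increment \<alpha> n j)\<^sup>2 / 2) = \<alpha>\<^sup>2 / 24 * (1 - 1 / (real n)\<^sup>2)"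
      using sum_parabola_increment_squared[OF assms, of \<alpha>] by (simp add: sum_divide_distrib[symmetric])
    then show "(\<Sum>j<n.
      real n * (W i (real (Suc j) / real n) \<omega> - W i (real j / real n) \<omega>) * parabola_increment \<alpha> n j
        - real n * (parabola_increment \<alpha> n j)\<^sup>2 / 2) =
      \<alpha> * ((W i 1 \<omega> + W i 0 \<omega>) / 2 + (W i 1 \<omega> - W i 0 \<omega>) / (2 * real n)
        - (\<Sum>j<n. W i (real (Suc j) / real n) \<omega>) / real n)
       - \<alpha>\<^sup>2 / 24 * (1 - 1 / (real n)\<^sup>2)"
      using sum_increments_parabola[OF assms, of "\<lambda>j. W i (real j / real n) \<omega>" \<alpha>] assms
      by (simp add: sum_subtractf)
  qed
  finally show ?thesis .
qed

lemma grid_exponent_tendsto: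
  assumes "\<And>i. i \<in> K \<Longrightarrow> continuous_on {0..1} (\<lambda>t. W i t \<omega>)"
  shows "(\<lambda>n. grid_exponent \<alpha> K W n \<omega>) \<longlonglongrightarrow> path_exponent \<alpha> K W \<omega>"
proof -
  have "(\<lambda>n. \<Sum>i\<in>K. \<alpha> * ((W i 1 \<omega> + W i 0 \<omega>) / 2 + (W i 1 \<omega> - W i 0 \<omega>) / 2 * inverse (real n)
        - 1 / real n * (\<Sum>j<n. W i (real (Suc j) / real n) \<omega>))
       - \<alpha>\<^sup>2 / 24 * (1 - inverse (real n) * inverse (real n)))
     \<longlonglongrightarrow> (\<Sum>i\<in>K. \<alpha> * ((W i 1 \<omega> + W i 0 \<omega>) / 2 + (W i 1 \<omega> - W i 0 \<omega>) / 2 * 0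
        - integral {0..1} (\<lambda>t. W i t \<omega>)) - \<alpha>\<^sup>2 / 24 * (1 - 0 * 0))"
  proof (intro tendsto_intros lim_inverse_n)
    fix i assume "i \<in> K"
    then show "(\<lambda>n. 1 / real n * (\<Sum>j<n. W i (real (Suc j) / real n) \<omega>))
      \<longlonglongrightarrow> integral {0..1} (\<lambda>t. W i t \<omega>)"
      using right_riemann_sums_tendsto_integral[OF _ assms, of i] by simp
  qed
  then have "(\<lambda>n. \<Sum>i\<in>K. \<alpha> * ((W i 1 \<omega> + W i 0 \<omega>) / 2 + (W i 1 \<omega> - W i 0 \<omega>) / 2 * inverse (real n)
        - 1 / real n * (\<Sum>j<n. W i (real (Suc j) / real n) \<omega>))
       - \<alpha>\<^sup>2 / 24 * (1 - inverse (real n) * inverse (real n)))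
     \<longlonglongrightarrow> path_exponent \<alpha> K W \<omega>"
    by (simp add: path_exponent_def)
  then show ?thesis
  proof (rule Lim_transform_eventually)
    have e: "x / 2 * inverse y = x / (2 * y)" "1 / y * x = x / y" "inverse y * inverse y = 1 / y\<^sup>2"
      for x y :: real
      by (simp_all add: field_simps power2_eq_square)
    show "\<forall>\<^sub>F n in sequentially.
       (\<Sum>i\<in>K. \<alpha> * ((W i 1 \<omega> + W i 0 \<omega>) / 2 + (W i 1 \<omega> - W i 0 \<omega>) / 2 * inverse (real n)
        - 1 / real n * (\<Sum>j<n. W i (real (Suc j) / real n) \<omega>))
       - \<alpha>\<^sup>2 / 24 * (1 - inverse (real n) * inverse (real n))) = grid_exponent \<alpha> K W n \<omega>"
      using eventually_gt_at_top[of 0]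
      unfolding e by eventually_elim (simp only: grid_exponent_eq)
  qed
qed

text \<open>The term linear in the path doubles with \<open>\<alpha>\<close>, so squaring the density gives the density for
  \<open>2 * \<alpha>\<close> up to a deterministic factor. As densities have mean one, this bounds the second
  moments uniformly in \<open>n\<close>.\<close>

lemma exp_grid_exponent_squared_le:
  assumes "n > 0"
  shows "(exp (grid_exponent \<alpha> K W n \<omega>))\<^sup>2 \<le>
    exp (real (card K) * \<alpha>\<^sup>2 / 12) * exp (grid_exponent (2 * \<alpha>) K W n \<omega>)"
proof -
  have *: "2 * (\<alpha> * S - \<alpha>\<^sup>2 / 24 * y) = 2 * \<alpha> * S - (2 * \<alpha>)\<^sup>2 / 24 * y + \<alpha>\<^sup>2 / 12 * y"
    for S y :: real
    by (simp add: field_simps power2_eq_square)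
  have "2 * grid_exponent \<alpha> K W n \<omega> = grid_exponent (2 * \<alpha>) K W n \<omega> +
      (\<Sum>i\<in>K. \<alpha>\<^sup>2 / 12 * (1 - 1 / (real n)\<^sup>2))"
    unfolding grid_exponent_eq[OF assms] sum_distrib_left sum.distrib[symmetric]
    by (intro sum.cong refl *)
  also have "\<dots> \<le> grid_exponent (2 * \<alpha>) K W n \<omega> + (\<Sum>i\<in>K. \<alpha>\<^sup>2 / 12)"
    by (intro add_left_mono sum_mono mult_left_le) auto
  finally have "2 * grid_exponent \<alpha> K W n \<omega> \<le>
      real (card K) * \<alpha>\<^sup>2 / 12 + grid_exponent (2 * \<alpha>) K W n \<omega>" by simp
  then have "exp (2 * grid_exponent \<alpha> K W n \<omega>) \<le>
      exp (real (card K) * \<alpha>\<^sup>2 / 12 + grid_exponent (2 * \<alpha>) K W n \<omega>)" by simp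
  then show ?thesis by (simp add: exp_add exp_double)
qed

locale brownian_lines =
  fixes M :: "'w measure" and K :: "int set" and W :: "int \<Rightarrow> real \<Rightarrow> 'w \<Rightarrow> real"
  assumes BMs: "indep_standard_BMs M K W" and finite_K: "finite K"
begin

lemma prob_space_M: "prob_space M"
  using BMs by (simp add: indep_standard_BMs_def)

sublocale prob_space M by (rule prob_space_M)

lemma BM: "i \<in> K \<Longrightarrow> standard_BM M (W i)"
  using BMs by (simp add: indep_standard_BMs_def)

lemma measurable_W [measurable (raw)]:
  "i \<in> K \<Longrightarrow> t \<in> {0..1} \<Longrightarrow> W i t \<in> borel_measurable M"
  using BM[of i] by (simp add: standard_BM_def)

lemma continuous_W: "i \<in> K \<Longrightarrow> \<omega> \<in> space M \<Longrightarrow> continuous_on {0..1} (\<lambda>t. W i t \<omega>)"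
  using BM[of i] by (simp add: standard_BM_def)

lemma grid_in_unit: "j \<le> n \<Longrightarrow> real j / real n \<in> {0..1}"
  by (cases "n = 0") auto

lemma measurable_increments [measurable]:
  "increments K W n \<in> M \<rightarrow>\<^sub>M PiM (K \<times> {..<n}) (\<lambda>_. borel)"
  unfolding increments_def
proof (rule measurable_restrict)
  fix z assume "z \<in> K \<times> {..<n}"
  then obtain i j where z: "z = (i, j)" "i \<in> K" "j < n" by auto
  then have "W i (real (Suc j) / real n) \<in> borel_measurable M" "W i (real j / real n) \<in> borel_measurable M"
    using grid_in_unit[of "Suc j" n] grid_in_unit[of j n] by (auto intro!: measurable_W)
  then have "(\<lambda>x. W i (real (Suc j) / real n) x - W i (real j / real n) x) \<in> borel_measurable M"
    by measurable
  then show "(\<lambda>x. case z of (i, j) \<Rightarrow> W i (real (Suc j) / real n) x - W i (real j / real n) x)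
    \<in> borel_measurable M"
    by (simp add: z)
qed

lemma prob_increments_line:
  assumes i: "i \<in> K" and n: "n > 0" and A: "\<And>j. j < n \<Longrightarrow> A j \<in> sets borel"
  shows "prob {\<omega> \<in> space M. \<forall>j<n. W i (real (Suc j) / real n) \<omega> - W i (real j / real n) \<omega> \<in> A j}
    = (\<Prod>j<n. measure (gauss (1 / real n)) (A j))"
proof -
  let ?Y = "\<lambda>j \<omega>. W i (real (Suc j) / real n) \<omega> - W i (real j / real n) \<omega>"
  have "indep_vars (\<lambda>_. borel) ?Y {..<n}"
    using BM[OF i] grid_in_unit[of _ n] n unfolding standard_BM_def
    by (auto simp: divide_right_mono dest!: spec[of _ n] spec[of _ "\<lambda>j. real j / real n"])
  then have "prob (\<Inter>j\<in>{..<n}. ?Y j -` A j \<inter> space M) = (\<Prod>j<n. prob (?Y j -` A j \<inter> space M))"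
    using n A by (intro indep_varsD_finite) auto
  also have "\<dots> = (\<Prod>j<n. measure (gauss (1 / real n)) (A j))"
  proof (intro prod.cong refl)
    fix j assume j: "j \<in> {..<n}"
    have "distributed M lborel (?Y j) (normal_density 0 (sqrt (real (Suc j) / real n - real j / real n)))"
      using BM[OF i] grid_in_unit[of "Suc j" n] j n unfolding standard_BM_def
      by (auto simp: divide_strict_right_mono)
    moreover have "real (Suc j) / real n - real j / real n = 1 / real n"
      using n by (simp add: field_simps)
    ultimately have D: "distributed M lborel (?Y j) (normal_density 0 (sqrt (1 / real n)))" by simp
    have Y: "?Y j \<in> borel_measurable M" using distributed_measurable[OF D] by simp
    have "measure (gauss (1 / real n)) (A j) = measure (distr M lborel (?Y j)) (A j)"
      unfolding distributed_distr_eq_density[OF D] ..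
    also have "\<dots> = prob (?Y j -` A j \<inter> space M)"
      using A j Y by (intro measure_distr) auto
    finally show "prob (?Y j -` A j \<inter> space M) = measure (gauss (1 / real n)) (A j)" ..
  qed
  also have "(\<Inter>j\<in>{..<n}. ?Y j -` A j \<inter> space M) = {\<omega> \<in> space M. \<forall>j<n. ?Y j \<omega> \<in> A j}"
    using n by auto
  finally show ?thesis .
qed

text \<open>Independence within each line is part of the definition of a Brownian motion, independence between
  the lines is assumed; together they give the product form on rectangles.\<close>

lemma distr_increments:
  assumes n: "n > 0"
  shows "distr M (PiM (K \<times> {..<n}) (\<lambda>_. borel)) (increments K W n) =
         PiM (K \<times> {..<n}) (\<lambda>_. gauss (1 / real n))"
proof -
  have pg: "prob_space (gauss (1 / real n))" using n by (intro prob_space_normal_density) simp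
  interpret G: product_prob_space "\<lambda>_. gauss (1 / real n)"
    by (rule product_prob_spaceI) (rule pg)
  have s: "sets (PiM (K \<times> {..<n}) (\<lambda>_. gauss (1 / real n))) = sets (PiM (K \<times> {..<n}) (\<lambda>_. borel))"
    by (intro sets_PiM_cong) auto
  show ?thesis
  proof (rule G.PiM_eqI)
    fix A assume "\<And>z. z \<in> K \<times> {..<n} \<Longrightarrow> A z \<in> sets (gauss (1 / real n))"
    then have A: "\<And>i j. i \<in> K \<Longrightarrow> j < n \<Longrightarrow> A (i, j) \<in> sets borel" by auto
    have "emeasure (distr M (PiM (K \<times> {..<n}) (\<lambda>_. borel)) (increments K W n)) (Pi\<^sub>E (K \<times> {..<n}) A) =
        emeasure M (increments K W n -` Pi\<^sub>E (K \<times> {..<n}) A \<inter> space M)"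
      using A finite_K by (intro emeasure_distr sets_PiM_I_finite) auto
    also have "increments K W n -` Pi\<^sub>E (K \<times> {..<n}) A \<inter> space M = {\<omega> \<in> space M. \<forall>i\<in>K. \<forall>j<n.
        W i (real (Suc j) / real n) \<omega> - W i (real j / real n) \<omega> \<in> A (i, j)}" (is "_ = ?E")
      by (auto simp: increments_def PiE_iff)
    also have "emeasure M ?E = ennreal (\<Prod>i\<in>K. \<Prod>j<n. measure (gauss (1 / real n)) (A (i, j)))"
    proof (cases "K = {}")
      case True
      then show ?thesis by (simp add: emeasure_space_1)
    next
      case False
      let ?X = "\<lambda>i \<omega>. \<lambda>t\<in>{0..1::real}. W i t \<omega>"
      let ?P = "PiM {0..1::real} (\<lambda>_. borel) :: (real \<Rightarrow> real) measure"
      \<comment> \<open>The condition on line \<open>i\<close>, as an event of its own path space.\<close>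
      define C where "C i = {x \<in> space ?P. \<forall>j\<in>{..<n}. x (real (Suc j) / real n) - x (real j / real n) \<in> A (i, j)}" for i
      have ind: "indep_vars (\<lambda>_. ?P) ?X K"
        using BMs by (simp add: indep_standard_BMs_def)
      have C: "C i \<in> sets ?P" if i: "i \<in> K" for i
      proof -
        have "{x \<in> space ?P. x (real (Suc j) / real n) - x (real j / real n) \<in> A (i, j)} \<in> sets ?P"
          if j: "j < n" for j
        proof -
          have "(\<lambda>x. x (real (Suc j) / real n)) \<in> borel_measurable ?P"
            "(\<lambda>x. x (real j / real n)) \<in> borel_measurable ?P"
            using grid_in_unit[of "Suc j" n] grid_in_unit[of j n] j
            by (intro measurable_component_singleton; simp)+
          then have "(\<lambda>x. x (real (Suc j) / real n) - x (real j / real n)) \<in> borel_measurable ?P"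
            by (rule borel_measurable_diff)
          from measurable_sets[OF this A[OF i j]] show ?thesis
            by (simp add: vimage_def Int_def conj_commute)
        qed
        then have "{x \<in> space ?P. \<forall>j\<in>{..<n}. x (real (Suc j) / real n) - x (real j / real n) \<in> A (i, j)} \<in> sets ?P"
          unfolding pred_def[symmetric] by (intro pred_intros_finite(3)) auto
        then show ?thesis by (simp only: C_def)
      qed
      have g: "?X i \<omega> (real (Suc j) / real n) = W i (real (Suc j) / real n) \<omega>"
        "?X i \<omega> (real j / real n) = W i (real j / real n) \<omega>" if "j < n" for i j \<omega>
        by (rule restrict_apply', rule grid_in_unit, use that in simp)+
      have Ci: "?X i -` C i \<inter> space M = {\<omega> \<in> space M. \<forall>j<n.
          W i (real (Suc j) / real n) \<omega> - W i (real j / real n) \<omega> \<in> A (i, j)}" for i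
      proof (rule set_eqI)
        fix \<omega>
        have "?X i \<omega> \<in> space ?P" by (simp add: space_PiM)
        then show "\<omega> \<in> ?X i -` C i \<inter> space M \<longleftrightarrow> \<omega> \<in> {\<omega> \<in> space M. \<forall>j<n.
          W i (real (Suc j) / real n) \<omega> - W i (real j / real n) \<omega> \<in> A (i, j)}"
          unfolding C_def using g[of _ i \<omega>] by (auto simp del: of_nat_Suc restrict_apply)
      qed
      have E_eq: "?E = (\<Inter>i\<in>K. ?X i -` C i \<inter> space M)"
        unfolding Ci using False by blast
      have "prob ?E = (\<Prod>i\<in>K. prob (?X i -` C i \<inter> space M))"
        unfolding E_eq using False finite_K C by (intro indep_varsD_finite[OF ind]) auto
      also have "\<dots> = (\<Prod>i\<in>K. \<Prod>j<n. measure (gauss (1 / real n)) (A (i, j)))"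
        unfolding Ci using A n by (intro prod.cong refl prob_increments_line) auto
      finally show ?thesis by (simp add: emeasure_eq_measure)
    qed
    also have "\<dots> = (\<Prod>z\<in>K \<times> {..<n}. emeasure (gauss (1 / real n)) (A z))"
      by (simp add: prod.cartesian_product prod_ennreal[symmetric] G.M.emeasure_eq_measure case_prod_unfold)
    finally show "emeasure (distr M (PiM (K \<times> {..<n}) (\<lambda>_. borel)) (increments K W n)) (Pi\<^sub>E (K \<times> {..<n}) A) =
      (\<Prod>z\<in>K \<times> {..<n}. emeasure (gauss (1 / real n)) (A z))" .
  qed (auto simp: finite_K s)
qed

end


context brownian_lines begin

text \<open>The discrete Cameron-Martin formula: the change of variables for a single Gaussian variable,
  applied to each of the independent increments.\<close>

lemma grid_cameron_martin:
  assumes n: "n > 0" and B: "B \<in> sets (PiM (K \<times> {..<n}) (\<lambda>_. borel))"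
  shows "emeasure M {\<omega> \<in> space M.
      (\<lambda>z\<in>K \<times> {..<n}. increments K W n \<omega> z + parabola_increment \<alpha> n (snd z)) \<in> B} =
    (\<integral>\<^sup>+\<omega>. ennreal (exp (grid_exponent \<alpha> K W n \<omega>)) * indicator B (increments K W n \<omega>) \<partial>M)"
proof -
  let ?I = "K \<times> {..<n}"
  let ?P = "PiM ?I (\<lambda>_. borel) :: (int \<times> nat \<Rightarrow> real) measure"
  let ?G = "PiM ?I (\<lambda>_. gauss (1 / real n))"
  let ?T = "\<lambda>x. \<lambda>z\<in>?I. x z + parabola_increment \<alpha> n (snd z)"
  let ?D = "\<lambda>z x. exp (x * parabola_increment \<alpha> n (snd z) / (1 / real n)
    - (parabola_increment \<alpha> n (snd z))\<^sup>2 / (2 * (1 / real n)))"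
  have s [measurable_cong]: "sets ?G = sets ?P"
    by (intro sets_PiM_cong) auto
  have T: "?T \<in> ?G \<rightarrow>\<^sub>M ?G"
  proof (rule measurable_restrict)
    fix z assume "z \<in> ?I"
    then have "(\<lambda>x. x z) \<in> ?G \<rightarrow>\<^sub>M gauss (1 / real n)" by (rule measurable_component_singleton)
    then show "(\<lambda>x. x z + parabola_increment \<alpha> n (snd z)) \<in> ?G \<rightarrow>\<^sub>M gauss (1 / real n)"
      by simp
  qed
  have D [measurable]: "(\<lambda>x. \<Prod>z\<in>?I. ennreal (?D z (x z))) \<in> borel_measurable ?P"
  proof (rule borel_measurable_prod_ennreal)
    fix z assume "z \<in> ?I"
    then have [measurable]: "(\<lambda>x. x z) \<in> ?P \<rightarrow>\<^sub>M borel" by (rule measurable_component_singleton)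
    show "(\<lambda>x. ennreal (?D z (x z))) \<in> borel_measurable ?P" by measurable
  qed
  have eq: "distr ?G ?G ?T = density ?G (\<lambda>x. \<Prod>z\<in>?I. ennreal (?D z (x z)))"
    using n finite_K
    by (intro PiM_map_eq_density gauss_shift prob_space_normal_density) auto
  have "emeasure M {\<omega> \<in> space M. ?T (increments K W n \<omega>) \<in> B} =
      emeasure M (increments K W n -` (?T -` B \<inter> space ?P) \<inter> space M)"
    using measurable_space[OF measurable_increments[of n]]
    by (intro arg_cong[where f="emeasure M"]) auto
  also have "\<dots> = emeasure (distr M ?P (increments K W n)) (?T -` B \<inter> space ?P)"
    using measurable_sets[OF T, of B] B
    by (intro emeasure_distr[symmetric] measurable_increments) (auto simp: s sets_eq_imp_space_eq[OF s])
  also have "\<dots> = emeasure ?G (?T -` B \<inter> space ?G)"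
    by (simp only: distr_increments[OF n] sets_eq_imp_space_eq[OF s])
  also have "\<dots> = emeasure (distr ?G ?G ?T) B"
    using T B by (intro emeasure_distr[symmetric]) (auto simp: s)
  also have "\<dots> = (\<integral>\<^sup>+x. (\<Prod>z\<in>?I. ennreal (?D z (x z))) * indicator B x \<partial>?G)"
    unfolding eq using B by (intro emeasure_density) (auto simp: s)
  also have "\<dots> = (\<integral>\<^sup>+x. (\<Prod>z\<in>?I. ennreal (?D z (x z))) * indicator B x
      \<partial>distr M ?P (increments K W n))"
    by (simp only: distr_increments[OF n])
  also have "\<dots> = (\<integral>\<^sup>+\<omega>. (\<Prod>z\<in>?I. ennreal (?D z (increments K W n \<omega> z))) *
      indicator B (increments K W n \<omega>) \<partial>M)"
    using B by (intro nn_integral_distr measurable_increments borel_measurable_times_ennreal D) auto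
  also have "\<dots> = (\<integral>\<^sup>+\<omega>. ennreal (exp (grid_exponent \<alpha> K W n \<omega>)) *
      indicator B (increments K W n \<omega>) \<partial>M)"
  proof (intro nn_integral_cong arg_cong2[where f="(*)"] refl)
    fix \<omega>
    have "(\<Prod>z\<in>?I. ennreal (?D z (increments K W n \<omega> z))) =
        ennreal (exp (\<Sum>z\<in>?I. increments K W n \<omega> z * parabola_increment \<alpha> n (snd z) / (1 / real n)
    - (parabola_increment \<alpha> n (snd z))\<^sup>2 / (2 * (1 / real n))))"
      using finite_K by (subst prod_ennreal) (auto simp: exp_sum)
    also have "(\<Sum>z\<in>?I. increments K W n \<omega> z * parabola_increment \<alpha> n (snd z) / (1 / real n)
        - (parabola_increment \<alpha> n (snd z))\<^sup>2 / (2 * (1 / real n))) = grid_exponent \<alpha> K W n \<omega>"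
      unfolding grid_exponent_def
      by (intro sum.cong refl) (simp add: mult_ac)
    finally show "(\<Prod>z\<in>?I. ennreal (?D z (increments K W n \<omega> z))) =
      ennreal (exp (grid_exponent \<alpha> K W n \<omega>))" .
  qed
  finally show ?thesis .
qed

lemma measurable_grid_exponent [measurable]: "grid_exponent \<alpha> K W n \<in> borel_measurable M"
proof -
  have [measurable]: "(\<lambda>\<omega>. increments K W n \<omega> z) \<in> borel_measurable M" if "z \<in> K \<times> {..<n}" for z
    using measurable_compose[OF measurable_increments measurable_component_singleton[OF that]] .
  show ?thesis unfolding grid_exponent_def by measurable
qed

lemma path_exponent_tendsto:
  "\<omega> \<in> space M \<Longrightarrow> (\<lambda>n. grid_exponent \<alpha> K W n \<omega>) \<longlonglongrightarrow> path_exponent \<alpha> K W \<omega>"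
  by (intro grid_exponent_tendsto continuous_W)

lemma measurable_path_exponent [measurable]: "path_exponent \<alpha> K W \<in> borel_measurable M"
  by (rule borel_measurable_LIMSEQ_real[OF path_exponent_tendsto]) measurable

lemma nn_integral_exp_grid_exponent:
  assumes n: "n > 0"
  shows "(\<integral>\<^sup>+\<omega>. ennreal (exp (grid_exponent \<alpha> K W n \<omega>)) \<partial>M) = 1"
proof -
  let ?P = "PiM (K \<times> {..<n}) (\<lambda>_. borel) :: (int \<times> nat \<Rightarrow> real) measure"
  have "(\<integral>\<^sup>+\<omega>. ennreal (exp (grid_exponent \<alpha> K W n \<omega>)) \<partial>M) =
      (\<integral>\<^sup>+\<omega>. ennreal (exp (grid_exponent \<alpha> K W n \<omega>)) * indicator (space ?P) (increments K W n \<omega>) \<partial>M)"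
    using measurable_space[OF measurable_increments[of n]]
    by (intro nn_integral_cong) (auto simp: indicator_def)
  also have "\<dots> = emeasure M {\<omega> \<in> space M.
      (\<lambda>z\<in>K \<times> {..<n}. increments K W n \<omega> z + parabola_increment \<alpha> n (snd z)) \<in> space ?P}"
    by (rule grid_cameron_martin[OF n sets.top, symmetric])
  also have "\<dots> = 1"
    by (simp add: space_PiM emeasure_space_1)
  finally show ?thesis .
qed

text \<open>Fatou's lemma. The grids may refine along any sequence, since later only multiples of a given
  mesh are allowed.\<close>

lemma nn_integral_exp_path_exponent_le:
  assumes "\<And>m. r m > 0" "filterlim r at_top sequentially"
    and "Measurable.pred M P"
  shows "(\<integral>\<^sup>+\<omega>. ennreal (exp (path_exponent \<alpha> K W \<omega>)) * indicator {\<omega>. P \<omega>} \<omega> \<partial>M) \<le>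
    liminf (\<lambda>m. \<integral>\<^sup>+\<omega>. ennreal (exp (grid_exponent \<alpha> K W (r m) \<omega>)) * indicator {\<omega>. P \<omega>} \<omega> \<partial>M)"
proof -
  note [measurable] = assms(3)
  have "(\<integral>\<^sup>+\<omega>. ennreal (exp (path_exponent \<alpha> K W \<omega>)) * indicator {\<omega>. P \<omega>} \<omega> \<partial>M) =
      (\<integral>\<^sup>+\<omega>. liminf (\<lambda>m. ennreal (exp (grid_exponent \<alpha> K W (r m) \<omega>)) * indicator {\<omega>. P \<omega>} \<omega>) \<partial>M)"
  proof (intro nn_integral_cong lim_imp_Liminf[symmetric])
    fix \<omega> assume "\<omega> \<in> space M"
    then have "(\<lambda>m. exp (grid_exponent \<alpha> K W (r m) \<omega>)) \<longlonglongrightarrow> exp (path_exponent \<alpha> K W \<omega>)"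
      by (intro tendsto_exp filterlim_compose[OF path_exponent_tendsto assms(2)])
    then show "(\<lambda>m. ennreal (exp (grid_exponent \<alpha> K W (r m) \<omega>)) * indicator {\<omega>. P \<omega>} \<omega>)
      \<longlonglongrightarrow> ennreal (exp (path_exponent \<alpha> K W \<omega>)) * indicator {\<omega>. P \<omega>} \<omega>"
      by (cases "P \<omega>") (auto intro: tendsto_ennrealI)
  qed auto
  also have "\<dots> \<le> liminf (\<lambda>m. \<integral>\<^sup>+\<omega>. ennreal (exp (grid_exponent \<alpha> K W (r m) \<omega>)) * indicator {\<omega>. P \<omega>} \<omega> \<partial>M)"
    by (intro nn_integral_liminf) measurable
  finally show ?thesis .
qed

text \<open>Truncation makes dominated convergence available. Its cost is controlled by second moments:
  \<open>x - x\<^sup>2 / (4 R) \<le> min x R\<close> because \<open>(x - 2 R)\<^sup>2 \<ge> 0\<close>.\<close>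

lemma expectation_min_exp_path_exponent_ge:
  assumes R: "R > 0"
  shows "1 - exp (real (card K) * \<alpha>\<^sup>2 / 12) / (4 * R) \<le>
    expectation (\<lambda>\<omega>. min (exp (path_exponent \<alpha> K W \<omega>)) R)"
proof (rule LIMSEQ_le_const)
  let ?E = "\<lambda>\<alpha> m \<omega>. exp (grid_exponent \<alpha> K W (Suc m) \<omega>)"
  let ?C = "exp (real (card K) * \<alpha>\<^sup>2 / 12)"
  show "(\<lambda>m. expectation (\<lambda>\<omega>. min (?E \<alpha> m \<omega>) R)) \<longlonglongrightarrow>
    expectation (\<lambda>\<omega>. min (exp (path_exponent \<alpha> K W \<omega>)) R)"
  proof (rule integral_dominated_convergence[where w="\<lambda>_. R"])
    show "AE \<omega> in M. (\<lambda>m. min (?E \<alpha> m \<omega>) R) \<longlonglongrightarrow> min (exp (path_exponent \<alpha> K W \<omega>)) R"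
      by (intro AE_I2 tendsto_min tendsto_exp tendsto_const
          filterlim_compose[OF path_exponent_tendsto filterlim_Suc])
  qed (use R in \<open>auto simp: min_def\<close>)
  have E1: "integrable M (?E \<beta> m)" "expectation (?E \<beta> m) = 1" for \<beta> m
  proof -
    have "has_bochner_integral M (?E \<beta> m) 1"
      using nn_integral_exp_grid_exponent[of "Suc m" \<beta>]
      by (intro has_bochner_integral_nn_integral) auto
    then show "integrable M (?E \<beta> m)" "expectation (?E \<beta> m) = 1"
      by (auto simp: has_bochner_integral_iff)
  qed
  have "1 - ?C / (4 * R) \<le> expectation (\<lambda>\<omega>. min (?E \<alpha> m \<omega>) R)" for m
  proof -
    have "expectation (\<lambda>\<omega>. ?E \<alpha> m \<omega> - ?C / (4 * R) * ?E (2 * \<alpha>) m \<omega>) \<le>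
        expectation (\<lambda>\<omega>. min (?E \<alpha> m \<omega>) R)"
    proof (rule integral_mono)
      show "integrable M (\<lambda>\<omega>. ?E \<alpha> m \<omega> - ?C / (4 * R) * ?E (2 * \<alpha>) m \<omega>)"
        by (intro Bochner_Integration.integrable_diff integrable_mult_right E1)
      show "integrable M (\<lambda>\<omega>. min (?E \<alpha> m \<omega>) R)"
        using R by (intro integrable_const_bound[where B=R]) (auto simp: min_def)
      fix \<omega>
      have "x - x\<^sup>2 / (4 * R) \<le> min x R" for x :: real
      proof -
        have "0 \<le> (x - 2 * R)\<^sup>2" by simp
        then have "4 * R * x - x\<^sup>2 \<le> 4 * R * R"
          by (simp add: power2_eq_square algebra_simps)
        then have "x - x\<^sup>2 / (4 * R) \<le> R" using R by (simp add: field_simps)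
        moreover have "0 \<le> x\<^sup>2 / (4 * R)" using R by simp
        ultimately show ?thesis by (simp add: min_def)
      qed
      moreover have "(?E \<alpha> m \<omega>)\<^sup>2 / (4 * R) \<le> ?C * ?E (2 * \<alpha>) m \<omega> / (4 * R)"
        using R by (intro divide_right_mono exp_grid_exponent_squared_le) auto
      ultimately show "?E \<alpha> m \<omega> - ?C / (4 * R) * ?E (2 * \<alpha>) m \<omega> \<le> min (?E \<alpha> m \<omega>) R"
        by (smt (verit) times_divide_eq_left)
    qed
    then show ?thesis
      by (simp add: Bochner_Integration.integral_diff E1)
  qed
  then show "\<exists>N. \<forall>m\<ge>N. 1 - ?C / (4 * R) \<le> expectation (\<lambda>\<omega>. min (?E \<alpha> m \<omega>) R)"
    by blast
qed

text \<open>Fatou's lemma gives at most one. The truncated expectations give at least \<open>1 - C / (4 R)\<close> for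
  every \<open>R\<close>, so no mass escapes in the limit.\<close>

lemma nn_integral_exp_path_exponent:
  "(\<integral>\<^sup>+\<omega>. ennreal (exp (path_exponent \<alpha> K W \<omega>)) \<partial>M) = 1"
proof (rule antisym)
  have "(\<integral>\<^sup>+\<omega>. ennreal (exp (path_exponent \<alpha> K W \<omega>)) * indicator {\<omega>. True} \<omega> \<partial>M) \<le>
    liminf (\<lambda>m. \<integral>\<^sup>+\<omega>. ennreal (exp (grid_exponent \<alpha> K W (Suc m) \<omega>)) * indicator {\<omega>. True} \<omega> \<partial>M)"
    by (rule nn_integral_exp_path_exponent_le) (auto intro: filterlim_Suc)
  then show "(\<integral>\<^sup>+\<omega>. ennreal (exp (path_exponent \<alpha> K W \<omega>)) \<partial>M) \<le> 1"
    by (simp add: nn_integral_exp_grid_exponent Liminf_const)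
next
  let ?C = "exp (real (card K) * \<alpha>\<^sup>2 / 12)"
  have "(\<lambda>m. ennreal (1 - ?C / 4 * inverse (real (Suc m)))) \<longlonglongrightarrow> ennreal (1 - ?C / 4 * 0)"
    by (intro tendsto_ennrealI tendsto_intros LIMSEQ_inverse_real_of_nat)
  then have "(\<lambda>m. ennreal (1 - ?C / 4 * inverse (real (Suc m)))) \<longlonglongrightarrow> 1" by simp
  then show "1 \<le> (\<integral>\<^sup>+\<omega>. ennreal (exp (path_exponent \<alpha> K W \<omega>)) \<partial>M)"
  proof (rule LIMSEQ_le_const2, intro exI allI impI)
    fix m :: nat
    let ?R = "real (Suc m)"
    have "1 - ?C / 4 * inverse ?R \<le> expectation (\<lambda>\<omega>. min (exp (path_exponent \<alpha> K W \<omega>)) ?R)"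
      using expectation_min_exp_path_exponent_ge[of ?R \<alpha>] by (simp add: field_simps)
    then have "ennreal (1 - ?C / 4 * inverse ?R) \<le>
        ennreal (expectation (\<lambda>\<omega>. min (exp (path_exponent \<alpha> K W \<omega>)) ?R))"
      by (rule ennreal_leI)
    also have "\<dots> = (\<integral>\<^sup>+\<omega>. ennreal (min (exp (path_exponent \<alpha> K W \<omega>)) ?R) \<partial>M)"
      by (intro nn_integral_eq_integral[symmetric] integrable_const_bound[where B="?R"])
         (auto simp: min_def)
    also have "\<dots> \<le> (\<integral>\<^sup>+\<omega>. ennreal (exp (path_exponent \<alpha> K W \<omega>)) \<partial>M)"
      by (intro nn_integral_mono ennreal_leI) simp
    finally show "ennreal (1 - ?C / 4 * inverse ?R) \<le>
      (\<integral>\<^sup>+\<omega>. ennreal (exp (path_exponent \<alpha> K W \<omega>)) \<partial>M)" .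
  qed
qed

text \<open>A Brownian motion starts at 0 only almost surely, and its increments determine it only up to
  its starting point; hence the starting value is subtracted.\<close>

definition centred_values :: "(int \<times> real) set \<Rightarrow> 'w \<Rightarrow> int \<times> real \<Rightarrow> real" where
  "centred_values J \<omega> = (\<lambda>(i, t)\<in>J. W i t \<omega> - W i 0 \<omega>)"

lemma measurable_values [measurable]:
  assumes "J \<subseteq> K \<times> {0..1}" shows "centred_values J \<in> M \<rightarrow>\<^sub>M PiM J (\<lambda>_. borel)"
  unfolding centred_values_def
proof (rule measurable_restrict)
  fix z assume "z \<in> J"
  then obtain i t where z: "z = (i, t)" "i \<in> K" "t \<in> {0..1}" using assms by auto
  then have [measurable]: "W i t \<in> borel_measurable M" "W i 0 \<in> borel_measurable M" by auto
  show "(\<lambda>\<omega>. case z of (i, t) \<Rightarrow> W i t \<omega> - W i 0 \<omega>) \<in> borel_measurable M"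
    by (simp add: z(1))
qed

text \<open>If all times in \<open>J\<close> lie on the grid, then the values at these times are partial sums of the grid
  increments.\<close>

lemma cameron_martin_values_grid:
  assumes n: "n > 0" and J: "J \<subseteq> K \<times> {0..1}" "finite J"
    and grid: "\<And>z. z \<in> J \<Longrightarrow> \<exists>m\<le>n. snd z = real m / real n"
    and B: "B \<in> sets (PiM J (\<lambda>_. borel))"
  shows "emeasure M {\<omega> \<in> space M. (\<lambda>z\<in>J. centred_values J \<omega> z + parabola \<alpha> (snd z)) \<in> B} =
    (\<integral>\<^sup>+\<omega>. ennreal (exp (grid_exponent \<alpha> K W n \<omega>)) * indicator {\<omega>. centred_values J \<omega> \<in> B} \<omega> \<partial>M)"
proof -
  let ?P = "PiM (K \<times> {..<n}) (\<lambda>_. borel) :: (int \<times> nat \<Rightarrow> real) measure"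
  have "\<forall>z. \<exists>m. z \<in> J \<longrightarrow> m \<le> n \<and> snd z = real m / real n"
    using grid by metis
  then obtain m where m: "\<And>z. z \<in> J \<Longrightarrow> m z \<le> n \<and> snd z = real (m z) / real n"
    by metis
  define s where "s x = (\<lambda>z\<in>J. \<Sum>l<m z. x (fst z, l))" for x :: "int \<times> nat \<Rightarrow> real"
  have s [measurable]: "s \<in> ?P \<rightarrow>\<^sub>M PiM J (\<lambda>_. borel)"
    unfolding s_def
  proof (intro measurable_restrict borel_measurable_sum)
    fix z l assume "z \<in> J" "l \<in> {..<m z}"
    then show "(\<lambda>x. x (fst z, l)) \<in> borel_measurable ?P"
      using J m by (intro measurable_component_singleton) fastforce
  qed
  have in_grid: "(fst z, l) \<in> K \<times> {..<n}" if "z \<in> J" "l < m z" for z l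
    using m[OF that(1)] that J by auto
  have s1: "s (increments K W n \<omega>) = centred_values J \<omega>" for \<omega>
  proof (rule ext)
    fix z
    show "s (increments K W n \<omega>) z = centred_values J \<omega> z"
    proof (cases "z \<in> J")
      case True
      have "s (increments K W n \<omega>) z = (\<Sum>l<m z. W (fst z) (real (Suc l) / real n) \<omega> - W (fst z) (real l / real n) \<omega>)"
        using True in_grid[OF True] by (simp add: s_def increments_def del: of_nat_Suc cong: sum.cong_simp)
      also have "\<dots> = W (fst z) (real (m z) / real n) \<omega> - W (fst z) 0 \<omega>"
        by (subst sum_lessThan_telescope) simp
      also have "\<dots> = centred_values J \<omega> z"
        using True m[OF True] by (simp add: centred_values_def case_prod_unfold)
      finally show ?thesis .
    qed (simp add: s_def centred_values_def)
  qed
  have s2: "s (\<lambda>z\<in>K \<times> {..<n}. increments K W n \<omega> z + parabola_increment \<alpha> n (snd z)) =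
      (\<lambda>z\<in>J. centred_values J \<omega> z + parabola \<alpha> (snd z))" for \<omega>
  proof (rule ext)
    fix z
    show "s (\<lambda>z\<in>K \<times> {..<n}. increments K W n \<omega> z + parabola_increment \<alpha> n (snd z)) z =
      (\<lambda>z\<in>J. centred_values J \<omega> z + parabola \<alpha> (snd z)) z"
    proof (cases "z \<in> J")
      case True
      have "s (\<lambda>z\<in>K \<times> {..<n}. increments K W n \<omega> z + parabola_increment \<alpha> n (snd z)) z =
          s (increments K W n \<omega>) z + (\<Sum>l<m z. parabola_increment \<alpha> n l)"
        using True in_grid[OF True] by (simp add: s_def sum.distrib cong: sum.cong_simp)
      also have "(\<Sum>l<m z. parabola_increment \<alpha> n l) = parabola \<alpha> (snd z)"
        unfolding parabola_increment_def using m[OF True]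
        by (subst sum_lessThan_telescope) (simp add: parabola_def)
      finally show ?thesis unfolding s1 restrict_apply'[OF True] .
    qed (simp add: s_def)
  qed
  let ?B = "s -` B \<inter> space ?P"
  have B': "?B \<in> sets ?P" using s B by (rule measurable_sets)
  have sp: "increments K W n \<omega> \<in> space ?P" if "\<omega> \<in> space M" for \<omega>
    using measurable_space[OF measurable_increments that] .
  have "{\<omega> \<in> space M. (\<lambda>z\<in>J. centred_values J \<omega> z + parabola \<alpha> (snd z)) \<in> B} = {\<omega> \<in> space M.
      (\<lambda>z\<in>K \<times> {..<n}. increments K W n \<omega> z + parabola_increment \<alpha> n (snd z)) \<in> ?B}"
    by (auto simp: s2 space_PiM)
  also have "emeasure M \<dots> =
      (\<integral>\<^sup>+\<omega>. ennreal (exp (grid_exponent \<alpha> K W n \<omega>)) * indicator ?B (increments K W n \<omega>) \<partial>M)"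
    by (rule grid_cameron_martin[OF n B'])
  also have "\<dots> = (\<integral>\<^sup>+\<omega>. ennreal (exp (grid_exponent \<alpha> K W n \<omega>)) * indicator {\<omega>. centred_values J \<omega> \<in> B} \<omega> \<partial>M)"
    using sp by (intro nn_integral_cong) (auto simp: indicator_def s1)
  finally show ?thesis .
qed

text \<open>Rational times lie on a common grid, and on all of its refinements.\<close>

lemma common_grid:
  fixes J :: "('i \<times> real) set"
  assumes "finite J" and "\<And>z. z \<in> J \<Longrightarrow> snd z \<in> \<rat> \<inter> {0..1}"
  shows "\<exists>n>0. \<forall>k>0. \<forall>z\<in>J. \<exists>m\<le>n * k. snd z = real m / real (n * k)"
  using assms
proof (induction J rule: finite_induct)
  case (insert z J)
  have "\<exists>n>0. \<forall>k>0. \<forall>z\<in>J. \<exists>m\<le>n * k. snd z = real m / real (n * k)"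
    by (intro insert.IH insert.prems) simp
  then obtain n where n: "n > 0"
    "\<And>k z. k > 0 \<Longrightarrow> z \<in> J \<Longrightarrow> \<exists>m\<le>n * k. snd z = real m / real (n * k)"
    by (elim exE conjE) (meson)
  have z: "snd z \<in> \<rat>" "0 \<le> snd z" "snd z \<le> 1" using insert.prems[of z] by auto
  obtain p q :: nat where pq: "q \<noteq> 0" "\<bar>snd z\<bar> = real p / real q"
    using Rats_abs_nat_div_natE[OF z(1)] by metis
  have t: "snd z = real p / real q" using pq z by simp
  then have "p \<le> q" using z pq by simp
  show ?case
  proof (rule exI[of _ "q * n"], intro conjI allI impI ballI)
    show "0 < q * n" using n(1) pq(1) by simp
    fix k :: nat and y assume k: "0 < k" and y: "y \<in> insert z J"
    show "\<exists>m\<le>q * n * k. snd y = real m / real (q * n * k)"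
    proof (cases "y = z")
      case True
      have "snd y = real (p * (n * k)) / real (q * (n * k))"
        using True t n(1) k by simp
      then show ?thesis using \<open>p \<le> q\<close> by (intro exI[of _ "p * (n * k)"]) (auto simp: mult.assoc)
    next
      case False
      then show ?thesis using n(2)[of "q * k" y] y k pq(1) by (simp add: mult_ac)
    qed
  qed
qed auto

text \<open>Fatou's lemma along the refinements of a common grid bounds the integral of the limit density
  over an event by the probability of the shifted event. Summed over the event and its complement,
  both sides are one, so neither bound can be strict.\<close>

lemma cameron_martin_values:
  assumes J: "J \<subseteq> K \<times> (\<rat> \<inter> {0..1})" "finite J" and B: "B \<in> sets (PiM J (\<lambda>_. borel))"
  shows "emeasure M {\<omega> \<in> space M. (\<lambda>z\<in>J. centred_values J \<omega> z + parabola \<alpha> (snd z)) \<in> B} =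
    (\<integral>\<^sup>+\<omega>. ennreal (exp (path_exponent \<alpha> K W \<omega>)) * indicator {\<omega>. centred_values J \<omega> \<in> B} \<omega> \<partial>M)"
proof -
  let ?P = "PiM J (\<lambda>_. borel) :: (int \<times> real \<Rightarrow> real) measure"
  define p where "p B = emeasure M {\<omega> \<in> space M. (\<lambda>z\<in>J. centred_values J \<omega> z + parabola \<alpha> (snd z)) \<in> B}" for B
  define e where "e B = (\<integral>\<^sup>+\<omega>. ennreal (exp (path_exponent \<alpha> K W \<omega>)) * indicator {\<omega>. centred_values J \<omega> \<in> B} \<omega> \<partial>M)" for B
  have J': "J \<subseteq> K \<times> {0..1}" using J by auto
  have V [measurable]: "centred_values J \<in> M \<rightarrow>\<^sub>M ?P" by (rule measurable_values[OF J'])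
  have S [measurable]: "(\<lambda>\<omega>. \<lambda>z\<in>J. centred_values J \<omega> z + parabola \<alpha> (snd z)) \<in> M \<rightarrow>\<^sub>M ?P"
  proof (rule measurable_restrict)
    fix z assume "z \<in> J"
    from measurable_compose[OF V measurable_component_singleton[OF this]]
    show "(\<lambda>\<omega>. centred_values J \<omega> z + parabola \<alpha> (snd z)) \<in> borel_measurable M" by measurable
  qed
  have "\<exists>n>0. \<forall>k>0. \<forall>z\<in>J. \<exists>m\<le>n * k. snd z = real m / real (n * k)"
    using J by (intro common_grid) auto
  then obtain n where n: "n > 0"
    "\<And>k z. k > 0 \<Longrightarrow> z \<in> J \<Longrightarrow> \<exists>m\<le>n * k. snd z = real m / real (n * k)"
    by (elim exE conjE) (meson)
  have le: "e B \<le> p B" if B: "B \<in> sets ?P" for B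
  proof -
    note [measurable] = B
    have "filterlim (\<lambda>k. n * Suc k) at_top sequentially"
      using n(1) by (intro filterlim_subseq) (simp add: strict_mono_Suc_iff)
    then have "e B \<le> liminf (\<lambda>k. \<integral>\<^sup>+\<omega>. ennreal (exp (grid_exponent \<alpha> K W (n * Suc k) \<omega>)) *
        indicator {\<omega>. centred_values J \<omega> \<in> B} \<omega> \<partial>M)"
      unfolding e_def using n(1) by (intro nn_integral_exp_path_exponent_le) auto
    also have "\<dots> = liminf (\<lambda>k::nat. p B)"
    proof -
      have "(\<integral>\<^sup>+\<omega>. ennreal (exp (grid_exponent \<alpha> K W (n * Suc k) \<omega>)) *
        indicator {\<omega>. centred_values J \<omega> \<in> B} \<omega> \<partial>M) = p B" for k
        unfolding p_def
      proof (intro cameron_martin_values_grid[symmetric] J' J B)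
        show "0 < n * Suc k" using n(1) by simp
        show "\<exists>m\<le>n * Suc k. snd z = real m / real (n * Suc k)" if "z \<in> J" for z
          by (rule n(2)) (simp_all add: that)
      qed
      then show ?thesis by (simp only:)
    qed
    finally show ?thesis by (simp add: Liminf_const)
  qed
  let ?C = "space ?P - B"
  have C [measurable]: "?C \<in> sets ?P" using B by auto
  note [measurable] = B
  have Vs: "centred_values J \<omega> \<in> space ?P" if "\<omega> \<in> space M" for \<omega> using measurable_space[OF V that] .
  have "e B + e ?C = (\<integral>\<^sup>+\<omega>. ennreal (exp (path_exponent \<alpha> K W \<omega>)) * indicator {\<omega>. centred_values J \<omega> \<in> B} \<omega>
      + ennreal (exp (path_exponent \<alpha> K W \<omega>)) * indicator {\<omega>. centred_values J \<omega> \<in> ?C} \<omega> \<partial>M)"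
    unfolding e_def by (intro nn_integral_add[symmetric]) measurable
  also have "\<dots> = (\<integral>\<^sup>+\<omega>. ennreal (exp (path_exponent \<alpha> K W \<omega>)) \<partial>M)"
    using Vs by (intro nn_integral_cong) (auto simp: indicator_def)
  finally have e1: "e B + e ?C = 1" by (simp add: nn_integral_exp_path_exponent)
  have "p B + p ?C = emeasure M ({\<omega> \<in> space M. (\<lambda>z\<in>J. centred_values J \<omega> z + parabola \<alpha> (snd z)) \<in> B} \<union>
      {\<omega> \<in> space M. (\<lambda>z\<in>J. centred_values J \<omega> z + parabola \<alpha> (snd z)) \<in> ?C})"
    unfolding p_def by (intro plus_emeasure) auto
  also have "\<dots> = emeasure M (space M)"
    by (intro arg_cong[where f="emeasure M"]) (auto simp: space_PiM)
  finally have p1: "p B + p ?C = 1" by (simp add: emeasure_space_1)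
  have "p B \<le> e B"
  proof -
    have "p B + e ?C \<le> e B + e ?C"
      using le[OF C] e1 p1 by (metis add_left_mono)
    moreover have "e ?C \<noteq> \<top>" using e1 by (auto simp: top_unique)
    ultimately show ?thesis by (simp add: add.commute ennreal_add_left_cancel_le)
  qed
  with le[OF B] show ?thesis unfolding p_def e_def by (rule antisym[rotated])
qed

end


section \<open>Shifts of line ensembles\<close>

definition add_curve ::
  "int set \<Rightarrow> real set \<Rightarrow> (real \<Rightarrow> real) \<Rightarrow> (int \<times> real \<Rightarrow> real) \<Rightarrow> int \<times> real \<Rightarrow> real" where
  "add_curve S T h q = (\<lambda>(i, s)\<in>S \<times> T. q (i, s) + h s)"

lemma add_curve_apply: "i \<in> S \<Longrightarrow> s \<in> T \<Longrightarrow> add_curve S T h q (i, s) = q (i, s) + h s"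
  by (simp add: add_curve_def)

lemma add_curve_in_ens_space:
  assumes "q \<in> ens_space S T" "continuous_on T h"
  shows "add_curve S T h q \<in> ens_space S T"
proof -
  have "continuous_on T (\<lambda>s. add_curve S T h q (i, s))" if i: "i \<in> S" for i
  proof (rule continuous_on_eq)
    show "continuous_on T (\<lambda>s. q (i, s) + h s)"
      using assms i by (intro continuous_on_add) (auto simp: ens_space_iff)
  qed (simp add: add_curve_apply i)
  then show ?thesis by (simp add: ens_space_iff add_curve_def)
qed

lemma measurable_add_curve:
  assumes "continuous_on T h"
  shows "add_curve S T h \<in> ens_borel S T \<rightarrow>\<^sub>M ens_borel S T"
proof (rule measurable_ens_borelI)
  fix z assume z: "z \<in> S \<times> T"
  then have [measurable]: "(\<lambda>q. q z) \<in> borel_measurable (ens_borel S T)"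
    by (rule measurable_ens_eval)
  have "(\<lambda>q. q z + h (snd z)) \<in> borel_measurable (ens_borel S T)" by measurable
  then show "(\<lambda>q. add_curve S T h q z) \<in> borel_measurable (ens_borel S T)"
    using z by (simp add: add_curve_def case_prod_unfold)
qed (use assms in \<open>auto intro: add_curve_in_ens_space\<close>)

lemma add_curve_uminus_add_curve:
  "q \<in> extensional (S \<times> T) \<Longrightarrow> add_curve S T (\<lambda>s. - h s) (add_curve S T h q) = q"
  by (auto simp: add_curve_def fun_eq_iff extensional_def)


section \<open>The Cameron-Martin formula for the Wiener law\<close>

lemma unit_interval_rational_limit:
  assumes t: "t \<in> {0..1::real}"
  obtains u where "\<And>n. u n \<in> \<rat> \<inter> {0..1}" "u \<longlonglongrightarrow> t"
proof -
  define u where "u n = real_of_int \<lfloor>t * real (Suc n)\<rfloor> / real (Suc n)" for n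
  have le: "u n \<le> t" for n
    by (simp add: u_def field_simps)
  have ge: "t - inverse (real (Suc n)) \<le> u n" for n
  proof -
    have "t * real (Suc n) - 1 \<le> real_of_int \<lfloor>t * real (Suc n)\<rfloor>" by linarith
    then have "(t * real (Suc n) - 1) / real (Suc n) \<le> u n"
      unfolding u_def by (intro divide_right_mono) auto
    then show ?thesis by (simp add: diff_divide_distrib inverse_eq_divide)
  qed
  have "0 \<le> u n" for n
    unfolding u_def using t by (intro divide_nonneg_nonneg) auto
  moreover have "u n \<in> \<rat>" for n unfolding u_def by (intro Rats_divide) auto
  ultimately have "u n \<in> \<rat> \<inter> {0..1}" for n using le[of n] t by (auto intro: order_trans)
  moreover have "u \<longlonglongrightarrow> t"
  proof (rule tendsto_sandwich[where h="\<lambda>_. t"])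
    show "(\<lambda>n. t - inverse (real (Suc n))) \<longlonglongrightarrow> t"
      using tendsto_diff[OF tendsto_const[of t] LIMSEQ_inverse_real_of_nat] by simp
  qed (use le ge in \<open>auto intro!: always_eventually\<close>)
  ultimately show ?thesis using that by blast
qed

text \<open>A continuous path is determined by its values at rational times, so the evaluations at these
  times generate the Borel sets, and a finite measure on them is determined by its
  finite-dimensional marginals.\<close>

lemma measure_eqI_ens:
  assumes P: "sets P = sets (ens_borel K {0..1})" and Q: "sets Q = sets (ens_borel K {0..1})"
    and fin: "finite_measure P"
    and eq: "\<And>J B. J \<subseteq> K \<times> (\<rat> \<inter> {0..1}) \<Longrightarrow> finite J \<Longrightarrow> B \<in> sets (PiM J (\<lambda>_. borel)) \<Longrightarrow>
      emeasure P {w \<in> space P. restrict w J \<in> B} = emeasure Q {w \<in> space Q. restrict w J \<in> B}"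
  shows "P = Q"
proof -
  let ?I = "K \<times> (\<rat> \<inter> {0..1}) :: (int \<times> real) set"
  let ?S = "PiM ?I (\<lambda>_. borel) :: (int \<times> real \<Rightarrow> real) measure"
  let ?ev = "\<lambda>w. restrict w ?I :: int \<times> real \<Rightarrow> real"
  let ?X = "ens_space K {0..1}"
  have spP: "space P = ?X" "space Q = ?X"
    using sets_eq_imp_space_eq[OF P] sets_eq_imp_space_eq[OF Q] by auto
  have ev: "?ev \<in> ens_borel K {0..1} \<rightarrow>\<^sub>M ?S"
    by (intro measurable_restrict measurable_ens_eval) auto
  then have evP: "?ev \<in> P \<rightarrow>\<^sub>M ?S" and evQ: "?ev \<in> Q \<rightarrow>\<^sub>M ?S"
    using measurable_cong_sets[OF P refl, of ?S] measurable_cong_sets[OF Q refl, of ?S] by auto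
  have "distr P ?S ?ev = distr Q ?S ?ev"
  proof (rule measure_eqI_PiM_infinite)
    fix A J assume J: "finite J" "J \<subseteq> ?I" and A: "\<And>i. i \<in> J \<Longrightarrow> A i \<in> sets (borel :: real measure)"
    let ?E = "prod_emb ?I (\<lambda>_. borel) J (Pi\<^sub>E J A)"
    have B: "Pi\<^sub>E J A \<in> sets (PiM J (\<lambda>_. borel))" using A J by (intro sets_PiM_I_finite) auto
    have E: "?E \<in> sets ?S" using B J by (intro sets_PiM_I) (auto intro: A)
    have pre: "?ev -` ?E \<inter> ?X = {w \<in> ?X. restrict w J \<in> Pi\<^sub>E J A}"
      using J(2) by (auto simp: prod_emb_def space_PiM Int_absorb1)
    show "emeasure (distr P ?S ?ev) ?E = emeasure (distr Q ?S ?ev) ?E"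
      using eq[OF J(2,1) B]
      by (simp only: emeasure_distr[OF evP E] emeasure_distr[OF evQ E] spP pre)
  next
    show "finite_measure (distr P ?S ?ev)"
      by (rule finite_measure.finite_measure_distr[OF fin evP])
  qed simp_all
  show ?thesis
  proof (rule measure_eqI)
    show "sets P = sets Q" by (simp add: P Q)
    let ?N = "vimage_algebra ?X ?ev ?S"
    have evN: "?ev \<in> ?N \<rightarrow>\<^sub>M ?S"
      by (intro measurable_vimage_algebra1) (auto simp: space_PiM)
    have "(\<lambda>w. w) \<in> ?N \<rightarrow>\<^sub>M ens_borel K {0..1}"
    proof (rule measurable_ens_borelI)
      fix z assume "z \<in> K \<times> {0..1::real}"
      then obtain i t where z: "z = (i, t)" "i \<in> K" "t \<in> {0..1}" by auto
      obtain u where u: "\<And>n. u n \<in> \<rat> \<inter> {0..1}" "u \<longlonglongrightarrow> t"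
        using unit_interval_rational_limit[OF z(3)] by blast
      show "(\<lambda>w. w z) \<in> borel_measurable ?N"
      proof (rule borel_measurable_LIMSEQ_real)
        fix w assume "w \<in> space ?N"
        then have "continuous_on {0..1} (\<lambda>t. w (i, t))"
          using z(2) by (simp add: ens_space_iff)
        then show "(\<lambda>n. w (i, u n)) \<longlonglongrightarrow> w z"
          unfolding z(1) using u(1)
          by (intro continuous_on_tendsto_compose[OF _ u(2) z(3)] always_eventually) auto
      next
        fix n
        have I: "(i, u n) \<in> ?I" using z(2) u(1)[of n] by auto
        show "(\<lambda>w. w (i, u n)) \<in> borel_measurable ?N"
          using measurable_compose[OF evN measurable_component_singleton[OF I]]
          by (simp only: restrict_apply'[OF I])
      qed
    qed simp
    then have sub: "sets (ens_borel K {0..1}) \<subseteq> sets ?N"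
      by (auto dest!: measurable_sets) (metis (no_types, lifting) Int_absorb2 sets.sets_into_space space_ens_borel space_vimage_algebra)
    fix A assume "A \<in> sets P"
    then have "A \<in> sets ?N" using sub P by auto
    then obtain B where B: "B \<in> sets ?S" "A = ?ev -` B \<inter> ?X"
      by (subst (asm) sets_vimage_algebra2) (auto simp: space_PiM)
    show "emeasure P A = emeasure Q A"
      using \<open>distr P ?S ?ev = distr Q ?S ?ev\<close> emeasure_distr[OF evP B(1)] emeasure_distr[OF evQ B(1)]
      by (simp add: spP B(2))
  qed
qed

text \<open>Almost surely \<open>w (i, 0) = 0\<close>, so the formula for centred values is a formula for the values
  themselves.\<close>

lemma wiener_cameron_martin:
  assumes K: "finite K" and P: "is_wiener_law K P"
  shows "distr P P (add_curve K {0..1} (parabola \<alpha>)) =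
    density P (\<lambda>w. ennreal (exp (path_exponent \<alpha> K (\<lambda>i t w. w (i, t)) w)))"
proof -
  let ?W = "\<lambda>i t w. w (i, t) :: real"
  interpret brownian_lines P K ?W
    using K P by unfold_locales (auto simp: is_wiener_law_def)
  have sP: "sets P = sets (ens_borel K {0..1})" using P by (simp add: is_wiener_law_def)
  have spP: "space P = ens_space K {0..1}" using sets_eq_imp_space_eq[OF sP] by simp
  let ?T = "add_curve K {0..1} (parabola \<alpha>)"
  have "continuous_on {0..1} (parabola \<alpha>)"
    unfolding parabola_def by (intro continuous_intros)
  then have "?T \<in> ens_borel K {0..1} \<rightarrow>\<^sub>M ens_borel K {0..1}" by (rule measurable_add_curve)
  then have T: "?T \<in> P \<rightarrow>\<^sub>M P" by (simp add: measurable_cong_sets[OF sP sP])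
  have start: "AE w in P. \<forall>i\<in>K. w (i, 0) = 0"
    using BM by (intro AE_finite_allI K) (auto simp: standard_BM_def)
  show ?thesis
  proof (rule measure_eqI_ens)
    show "finite_measure (distr P P ?T)"
      by (intro finite_measure.finite_measure_distr T) (rule finite_measure_axioms)
  next
    fix J and B :: "(int \<times> real \<Rightarrow> real) set"
    assume J: "J \<subseteq> K \<times> (\<rat> \<inter> {0..1})" "finite J" and B: "B \<in> sets (PiM J (\<lambda>_. borel))"
    have J': "J \<subseteq> K \<times> {0..1}" using J by auto
    have rJ: "(\<lambda>w. restrict w J) \<in> P \<rightarrow>\<^sub>M PiM J (\<lambda>_. borel)"
      using J' unfolding measurable_cong_sets[OF sP refl]
      by (intro measurable_restrict measurable_ens_eval) auto
    have V: "centred_values J \<in> P \<rightarrow>\<^sub>M PiM J (\<lambda>_. borel)" by (rule measurable_values[OF J'])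
    have V': "(\<lambda>w. \<lambda>z\<in>J. centred_values J w z + parabola \<alpha> (snd z)) \<in> P \<rightarrow>\<^sub>M PiM J (\<lambda>_. borel)"
    proof (rule measurable_restrict)
      fix z assume "z \<in> J"
      from measurable_compose[OF V measurable_component_singleton[OF this]]
      show "(\<lambda>w. centred_values J w z + parabola \<alpha> (snd z)) \<in> borel_measurable P" by measurable
    qed
    have E: "{w \<in> space P. restrict w J \<in> B} \<in> sets P"
      using measurable_sets[OF rJ B] by (simp add: vimage_def Int_def conj_commute)
    have "emeasure (distr P P ?T) {w \<in> space P. restrict w J \<in> B} =
        emeasure P (?T -` {w \<in> space P. restrict w J \<in> B} \<inter> space P)"
      by (rule emeasure_distr[OF T E])
    also have "\<dots> = emeasure P {w \<in> space P. (\<lambda>z\<in>J. centred_values J w z + parabola \<alpha> (snd z)) \<in> B}"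
    proof (rule emeasure_eq_AE)
      show "AE w in P. w \<in> ?T -` {w \<in> space P. restrict w J \<in> B} \<inter> space P \<longleftrightarrow>
        w \<in> {w \<in> space P. (\<lambda>z\<in>J. centred_values J w z + parabola \<alpha> (snd z)) \<in> B}"
        using start AE_space
      proof eventually_elim
        case (elim w)
        have "restrict (?T w) J = (\<lambda>z\<in>J. centred_values J w z + parabola \<alpha> (snd z))"
        proof (rule ext)
          fix z show "restrict (?T w) J z = (\<lambda>z\<in>J. centred_values J w z + parabola \<alpha> (snd z)) z"
            using J' elim(1) by (cases z) (auto simp: add_curve_def centred_values_def)
        qed
        moreover have "?T w \<in> space P" using measurable_space[OF T elim(2)] .
        ultimately show ?case using elim by simp
      qed
      show "?T -` {w \<in> space P. restrict w J \<in> B} \<inter> space P \<in> sets P"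
        using measurable_sets[OF T E] .
      show "{w \<in> space P. (\<lambda>z\<in>J. centred_values J w z + parabola \<alpha> (snd z)) \<in> B} \<in> sets P"
        using measurable_sets[OF V' B] by (simp add: vimage_def Int_def conj_commute)
    qed
    also have "\<dots> = (\<integral>\<^sup>+w. ennreal (exp (path_exponent \<alpha> K ?W w)) * indicator {w. centred_values J w \<in> B} w \<partial>P)"
      by (rule cameron_martin_values[OF J B])
    also have "\<dots> = (\<integral>\<^sup>+w. ennreal (exp (path_exponent \<alpha> K ?W w)) * indicator {w \<in> space P. restrict w J \<in> B} w \<partial>P)"
    proof (rule nn_integral_cong_AE)
      show "AE w in P. ennreal (exp (path_exponent \<alpha> K ?W w)) * indicator {w. centred_values J w \<in> B} w =
        ennreal (exp (path_exponent \<alpha> K ?W w)) * indicator {w \<in> space P. restrict w J \<in> B} w"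
        using start AE_space
      proof eventually_elim
        case (elim w)
        have "centred_values J w = restrict w J"
        proof (rule ext)
          fix z show "centred_values J w z = restrict w J z"
            using J' elim(1) by (cases z) (auto simp: centred_values_def)
        qed
        then show ?case using elim(2) by (simp add: indicator_def)
      qed
    qed
    also have "\<dots> = emeasure (density P (\<lambda>w. ennreal (exp (path_exponent \<alpha> K ?W w)))) {w \<in> space P. restrict w J \<in> B}"
      by (rule emeasure_density[symmetric, OF _ E]) measurable
    finally show "emeasure (distr P P ?T) {w \<in> space (distr P P ?T). restrict w J \<in> B} =
      emeasure (density P (\<lambda>w. ennreal (exp (path_exponent \<alpha> K ?W w))))
        {w \<in> space (density P (\<lambda>w. ennreal (exp (path_exponent \<alpha> K ?W w)))). restrict w J \<in> B}"
      by simp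
  qed (simp_all add: sP)
qed


section \<open>Shifting Brownian bridges\<close>

definition bridges ::
  "int set \<Rightarrow> real \<Rightarrow> real \<Rightarrow> (int \<Rightarrow> real) \<Rightarrow> (int \<Rightarrow> real) \<Rightarrow> (int \<times> real \<Rightarrow> real) \<Rightarrow> int \<times> real \<Rightarrow> real"
  where "bridges K a b x y w = (\<lambda>(i, r)\<in>K \<times> {a..b}. bridge_of a b (x i) (y i) (\<lambda>t. w (i, t)) r)"

lemma free_law_eq:
  "free_law k1 k2 a b x y =
     distr (wiener_law {k1..k2}) (ens_borel {k1..k2} {a..b}) (bridges {k1..k2} a b x y)"
  by (simp add: free_law_def bridges_def[abs_def])

lemma rescaled_time:
  fixes a b r :: real
  assumes "a < b" "r \<in> {a..b}" shows "(r - a) / (b - a) \<in> {0..1}"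
  using assms by (auto intro!: divide_nonneg_nonneg simp: divide_le_eq_1_pos)

lemma bridges_in_ens_space:
  assumes ab: "a < b" and w: "w \<in> ens_space K {0..1}"
  shows "bridges K a b x y w \<in> ens_space K {a..b}"
proof -
  have "continuous_on {a..b} (\<lambda>r. bridges K a b x y w (i, r))" if i: "i \<in> K" for i
  proof (rule continuous_on_eq)
    have cW: "continuous_on {0..1} (\<lambda>t. w (i, t))" using w i by (simp add: ens_space_iff)
    have ct: "continuous_on {a..b} (\<lambda>r. (r - a) / (b - a))"
      using ab by (intro continuous_on_divide continuous_on_diff continuous_on_id continuous_on_const) simp
    have "continuous_on {a..b} (\<lambda>r. w (i, (r - a) / (b - a)))"
      by (rule continuous_on_compose2[OF cW ct]) (use rescaled_time[OF ab] in blast)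
    then have "continuous_on {a..b} (\<lambda>r. sqrt (b - a) * (w (i, (r - a) / (b - a)) - (r - a) / (b - a) * w (i, 1))
        + (b - r) / (b - a) * x i + (r - a) / (b - a) * y i)"
      using ab ct
      by (intro continuous_on_add continuous_on_mult continuous_on_diff continuous_on_divide
          continuous_on_const continuous_on_id) simp_all
    then show "continuous_on {a..b} (\<lambda>r. bridge_of a b (x i) (y i) (\<lambda>t. w (i, t)) r)"
      by (simp only: bridge_of_def Let_def)
  qed (simp add: bridges_def i)
  then show ?thesis by (simp add: ens_space_iff bridges_def)
qed

lemma measurable_bridges:
  assumes ab: "a < b" shows "bridges K a b x y \<in> ens_borel K {0..1} \<rightarrow>\<^sub>M ens_borel K {a..b}"
proof (rule measurable_ens_borelI)
  fix z assume "z \<in> K \<times> {a..b}"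
  then obtain i r where z: "z = (i, r)" "i \<in> K" "r \<in> {a..b}" by auto
  have [measurable]: "(\<lambda>w. w (i, (r - a) / (b - a))) \<in> borel_measurable (ens_borel K {0..1})"
    "(\<lambda>w. w (i, 1)) \<in> borel_measurable (ens_borel K {0..1})"
    using z rescaled_time[OF ab z(3)] by (auto intro!: measurable_ens_eval)
  have "(\<lambda>w. bridge_of a b (x i) (y i) (\<lambda>t. w (i, t)) r) \<in> borel_measurable (ens_borel K {0..1})"
    unfolding bridge_of_def Let_def by measurable
  then show "(\<lambda>w. bridges K a b x y w z) \<in> borel_measurable (ens_borel K {0..1})"
    using z by (simp add: bridges_def)
qed (use ab in \<open>auto intro: bridges_in_ens_space\<close>)

text \<open>On the rescaled time \<open>t = (r - a) / (b - a)\<close> the curve \<open>h\<close> is the linear interpolation of its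
  endpoint values plus \<open>(A / 2) (b - a)\<^sup>2 t (t - 1)\<close>. The bridge multiplies its Brownian motion by
  \<open>sqrt (b - a)\<close>, whence the coefficient \<open>A * (b - a) * sqrt (b - a)\<close> of the parabola.\<close>

lemma bridge_of_shift:
  assumes ab: "a < b" and h: "\<And>r. h r = A / 2 * r\<^sup>2 + c * r + d"
    and W': "\<And>t. t \<in> {0..1} \<Longrightarrow> W' t = W t + parabola (A * (b - a) * sqrt (b - a)) t"
    and r: "r \<in> {a..b}"
  shows "bridge_of a b (x + h a) (y + h b) W' r = bridge_of a b x y W r + h r"
proof -
  define s t where "s = b - a" and "t = (r - a) / (b - a)"
  have s: "s > 0" and b: "b = a + s" and rt: "r = a + s * t"
    using ab by (auto simp: s_def t_def)
  have t: "t \<in> {0..1}" using rescaled_time[OF ab r] by (simp add: t_def)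
  have br: "(b - r) / s = 1 - t" using s unfolding b rt by (simp add: field_simps)
  have lin: "(b - r) / s * (x + h a) + t * (y + h b) =
      (b - r) / s * x + t * y + (h r - A / 2 * s\<^sup>2 * (t * (t - 1)))"
    unfolding br unfolding h b rt by (simp add: field_simps power2_eq_square)
  have "u * parabola (A * s * u) t = (u * u) * (A / 2 * s * (t * (t - 1)))" for u
    by (simp add: parabola_def)
  from this[of "sqrt s"] have "sqrt s * parabola (A * s * sqrt s) t = s * (A / 2 * s * (t * (t - 1)))"
    using s by (simp only: real_sqrt_mult_self abs_of_pos)
  then have "sqrt s * parabola (A * s * sqrt s) t = A / 2 * s\<^sup>2 * (t * (t - 1))"
    by (simp only: power2_eq_square mult_ac times_divide_eq_left times_divide_eq_right)
  moreover have "parabola (A * s * sqrt s) 1 = 0" by (simp add: parabola_def)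
  ultimately have "sqrt s * (W' t - t * W' 1) = sqrt s * (W t - t * W 1) + A / 2 * s\<^sup>2 * (t * (t - 1))"
    using W'[OF t] W'[of 1] by (simp add: s_def algebra_simps)
  then show ?thesis
    unfolding bridge_of_def Let_def t_def[symmetric] unfolding s_def[symmetric] using lin by linarith
qed

lemma add_curve_bridges:
  assumes ab: "a < b" and h: "\<And>r. h r = A / 2 * r\<^sup>2 + c * r + d"
    and x': "\<And>i. i \<in> K \<Longrightarrow> x' i = x i + h a" and y': "\<And>i. i \<in> K \<Longrightarrow> y' i = y i + h b"
  shows "add_curve K {a..b} h (bridges K a b x y w) =
    bridges K a b x' y' (add_curve K {0..1} (parabola (A * (b - a) * sqrt (b - a))) w)"
proof (rule ext, clarify)
  fix i r
  show "add_curve K {a..b} h (bridges K a b x y w) (i, r) =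
    bridges K a b x' y' (add_curve K {0..1} (parabola (A * (b - a) * sqrt (b - a))) w) (i, r)"
  proof (cases "i \<in> K \<and> r \<in> {a..b}")
    case True
    then have i: "i \<in> K" and r: "r \<in> {a..b}" by auto
    have "bridge_of a b (x i + h a) (y i + h b)
        (\<lambda>t. add_curve K {0..1} (parabola (A * (b - a) * sqrt (b - a))) w (i, t)) r =
      bridge_of a b (x i) (y i) (\<lambda>t. w (i, t)) r + h r"
      by (rule bridge_of_shift[OF ab h _ r]) (simp add: add_curve_apply i)
    then show ?thesis
      using i r by (simp add: add_curve_apply bridges_def x' y')
  qed (auto simp: add_curve_def bridges_def)
qed

lemma integral_bridge_of:
  assumes ab: "a < b" and W: "continuous_on {0..1} W"
  shows "integral {a..b} (bridge_of a b x y W) =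
    (b - a) * (sqrt (b - a) * (integral {0..1} W - W 1 / 2) + (x + y) / 2)"
proof -
  define s where "s = b - a"
  have s: "s > 0" using ab by (simp add: s_def)
  define f where "f t = sqrt s * (W t - t * W 1) + (1 - t) * x + t * y" for t
  have cf: "continuous_on {0..1} f" unfolding f_def using W by (intro continuous_intros)
  have "(W has_integral integral {0..1} W) {0..1}"
    using integrable_continuous_real[OF W] by (rule integrable_integral)
  moreover have id: "((\<lambda>t. t) has_integral 1 / 2) {0..1::real}"
    using ident_has_integral[of 0 1] by simp
  moreover have one: "((\<lambda>t. 1::real) has_integral 1) {0..1::real}"
    using has_integral_const_real[of "1::real" 0 1] by simp
  ultimately have "((\<lambda>t. sqrt s * (W t - W 1 * t) + (x * (1 - t) + y * t)) has_integral
      sqrt s * (integral {0..1} W - W 1 * (1 / 2)) + (x * (1 - 1 / 2) + y * (1 / 2))) {0..1}"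
    by (intro has_integral_add has_integral_mult_right has_integral_diff)
  then have f: "integral {0..1} f = sqrt s * (integral {0..1} W - W 1 / 2) + (x + y) / 2"
    by (intro integral_unique) (simp add: f_def[abs_def] algebra_simps add_divide_distrib)
  have g: "((\<lambda>r. (r - a) / s) has_real_derivative 1 / s) (at r within {a..b})" for r
  proof -
    have "((\<lambda>r. r - a) has_real_derivative 1 - 0) (at r within {a..b})"
      by (intro DERIV_diff DERIV_ident DERIV_const)
    from DERIV_cdivide[OF this, of s] show ?thesis by simp
  qed
  have "(\<lambda>r. (r - a) / s) ` {a..b} \<subseteq> {0..1}"
    using rescaled_time[OF ab] unfolding s_def by blast
  then have "((\<lambda>r. 1 / s * f ((r - a) / s)) has_integral integral {0..1} f) {a..b}"
    using has_integral_substitution[of a b "\<lambda>r. (r - a) / s" 0 1 f "\<lambda>_. 1 / s"] ab s cf g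
    by (simp add: s_def)
  then have "((\<lambda>r. s * (1 / s * f ((r - a) / s))) has_integral s * integral {0..1} f) {a..b}"
    by (rule has_integral_mult_right)
  moreover have "s * (1 / s * f ((r - a) / s)) = bridge_of a b x y W r" for r
  proof -
    have b: "b = a + s" by (simp add: s_def)
    have e: "1 - (r - a) / s = (b - r) / s" using s unfolding b by (simp add: field_simps)
    have c: "s * (1 / s * z) = z" for z using s by simp
    show ?thesis unfolding c bridge_of_def Let_def s_def[symmetric] f_def e ..
  qed
  ultimately have "(bridge_of a b x y W has_integral s * integral {0..1} f) {a..b}" by simp
  then show ?thesis unfolding f s_def by (rule integral_unique)
qed

text \<open>The area is a limit of Riemann sums, each of which involves finitely many evaluations.\<close>

lemma measurable_area_weight:
  assumes ab: "a \<le> b" and g: "continuous_on {a..b} g"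
  shows "area_weight k1 k2 a b A g \<in> borel_measurable (ens_borel {k1..k2} {a..b})"
proof -
  have [measurable]: "(\<lambda>q. integral {a..b} (\<lambda>u. A i * (q (i, u) - g u))) \<in> borel_measurable (ens_borel {k1..k2} {a..b})"
    if i: "i \<in> {k1..k2}" for i
  proof (rule borel_measurable_LIMSEQ_real)
    fix q assume "q \<in> space (ens_borel {k1..k2} {a..b})"
    then have "continuous_on {a..b} (\<lambda>u. A i * (q (i, u) - g u))"
      using i g by (intro continuous_intros) (auto simp: ens_space_iff)
    from right_riemann_sums_tendsto_integral[OF ab this]
    show "(\<lambda>n. (b - a) / real n * (\<Sum>j<n. A i * (q (i, a + (b - a) * real (Suc j) / real n) - g (a + (b - a) * real (Suc j) / real n))))
      \<longlonglongrightarrow> integral {a..b} (\<lambda>u. A i * (q (i, u) - g u))" .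
  next
    fix n
    have "(\<lambda>q. A i * (q (i, a + (b - a) * real (Suc j) / real n) - g (a + (b - a) * real (Suc j) / real n)))
      \<in> borel_measurable (ens_borel {k1..k2} {a..b})" if j: "j < n" for j
    proof -
      have "(b - a) * real (Suc j) \<le> (b - a) * real n" using ab j by (intro mult_left_mono) auto
      then have "(b - a) * real (Suc j) / real n \<le> b - a" using j by (simp add: divide_le_eq)
      then have "(i, a + (b - a) * real (Suc j) / real n) \<in> {k1..k2} \<times> {a..b}"
        using i ab by auto
      then have [measurable]: "(\<lambda>q. q (i, a + (b - a) * real (Suc j) / real n)) \<in> borel_measurable (ens_borel {k1..k2} {a..b})"
        by (rule measurable_ens_eval)
      show ?thesis by measurable
    qed
    then have "(\<lambda>q. \<Sum>j<n. A i * (q (i, a + (b - a) * real (Suc j) / real n) - g (a + (b - a) * real (Suc j) / real n)))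
      \<in> borel_measurable (ens_borel {k1..k2} {a..b})"
      by (intro borel_measurable_sum) (simp only: lessThan_iff)
    then show "(\<lambda>q. (b - a) / real n * (\<Sum>j<n. A i * (q (i, a + (b - a) * real (Suc j) / real n) - g (a + (b - a) * real (Suc j) / real n))))
      \<in> borel_measurable (ens_borel {k1..k2} {a..b})"
      by (rule borel_measurable_times[OF borel_measurable_const])
  qed
  show ?thesis unfolding area_weight_def[abs_def] by measurable
qed

text \<open>The Cameron-Martin density is a function of the bridges alone: scaling turns
  \<open>A * (b - a) * sqrt (b - a)\<close> times the area under the standard bridge into \<open>A\<close> times the area
  under the bridge on \<open>[a, b]\<close>. The endpoint values, the lower boundary \<open>g\<close> and the normalisation only enter the constant \<open>C\<close>.\<close>

lemma exp_path_exponent_eq_area_weight: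
  assumes ab: "a < b" and g: "continuous_on {a..b} g"
  obtains C where "C > 0" and "\<And>w. w \<in> ens_space {k1..k2} {0..1} \<Longrightarrow>
    (\<And>i. i \<in> {k1..k2} \<Longrightarrow> w (i, 0) = 0) \<Longrightarrow>
    exp (path_exponent (A * (b - a) * sqrt (b - a)) {k1..k2} (\<lambda>i t w. w (i, t)) w) =
    C * area_weight k1 k2 a b (\<lambda>_. A) g (bridges {k1..k2} a b x y w)"
proof
  define \<alpha> where "\<alpha> = A * (b - a) * sqrt (b - a)"
  define C where "C = exp (\<Sum>i\<in>{k1..k2}. A * (b - a) * (x i + y i) / 2 - A * integral {a..b} g - \<alpha>\<^sup>2 / 24)"
  show "C > 0" by (simp add: C_def)
  fix w assume w: "w \<in> ens_space {k1..k2} {0..1}" and w0: "\<And>i. i \<in> {k1..k2} \<Longrightarrow> w (i, 0) = 0"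
  have "path_exponent \<alpha> {k1..k2} (\<lambda>i t w. w (i, t)) w =
    (\<Sum>i\<in>{k1..k2}. A * (b - a) * (x i + y i) / 2 - A * integral {a..b} g - \<alpha>\<^sup>2 / 24) -
    (\<Sum>i\<in>{k1..k2}. integral {a..b} (\<lambda>u. A * (bridges {k1..k2} a b x y w (i, u) - g u)))"
    unfolding path_exponent_def sum_subtractf[symmetric]
  proof (intro sum.cong refl)
    fix i assume i: "i \<in> {k1..k2}"
    let ?W = "\<lambda>t. w (i, t)"
    have cW: "continuous_on {0..1} ?W" using w i by (simp add: ens_space_iff)
    have cB: "continuous_on {a..b} (\<lambda>r. bridges {k1..k2} a b x y w (i, r))"
      using bridges_in_ens_space[OF ab w] i by (simp add: ens_space_iff)
    have "integral {a..b} (\<lambda>u. A * (bridges {k1..k2} a b x y w (i, u) - g u)) =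
        A * (integral {a..b} (\<lambda>r. bridges {k1..k2} a b x y w (i, r)) - integral {a..b} g)"
      using cB g
      by (simp add: Henstock_Kurzweil_Integration.integral_diff integrable_continuous_real)
    also have "integral {a..b} (\<lambda>r. bridges {k1..k2} a b x y w (i, r)) =
        integral {a..b} (bridge_of a b (x i) (y i) ?W)"
      using i by (intro Henstock_Kurzweil_Integration.integral_cong) (simp add: bridges_def)
    also have "\<dots> = (b - a) * (sqrt (b - a) * (integral {0..1} ?W - w (i, 1) / 2) + (x i + y i) / 2)"
      by (rule integral_bridge_of[OF ab cW])
    finally have eq: "integral {a..b} (\<lambda>u. A * (bridges {k1..k2} a b x y w (i, u) - g u)) =
        A * ((b - a) * (sqrt (b - a) * (integral {0..1} ?W - w (i, 1) / 2) + (x i + y i) / 2)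
          - integral {a..b} g)" .
    show "\<alpha> * ((w (i, 1) + w (i, 0)) / 2 - integral {0..1} ?W) - \<alpha>\<^sup>2 / 24 =
        A * (b - a) * (x i + y i) / 2 - A * integral {a..b} g - \<alpha>\<^sup>2 / 24
        - integral {a..b} (\<lambda>u. A * (bridges {k1..k2} a b x y w (i, u) - g u))"
      unfolding eq w0[OF i] \<alpha>_def by (simp add: field_simps)
  qed
  then show "exp (path_exponent (A * (b - a) * sqrt (b - a)) {k1..k2} (\<lambda>i t w. w (i, t)) w) =
    C * area_weight k1 k2 a b (\<lambda>_. A) g (bridges {k1..k2} a b x y w)"
    unfolding \<alpha>_def[symmetric] C_def area_weight_def mult_exp_exp by simp
qed

text \<open>In the default case all laws built from the Wiener law are null measures, and the identities below
  hold because both sides vanish.\<close>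

lemma wiener_law_cases:
  assumes "is_wiener_law K (wiener_law K) \<Longrightarrow> thesis"
    and "wiener_law K = null_measure (ens_borel K {0..1}) \<Longrightarrow> thesis"
  shows thesis
proof (cases "\<exists>P. is_wiener_law K P")
  case True
  then show ?thesis
    using assms(1) someI_ex[OF True] by (simp add: wiener_law_def)
next
  case False
  then show ?thesis using assms(2) by (simp add: wiener_law_def)
qed

lemma sets_wiener_law: "sets (wiener_law K) = sets (ens_borel K {0..1})"
  by (rule wiener_law_cases[of K]) (simp_all add: is_wiener_law_def)

lemma sets_free_law [simp]: "sets (free_law k1 k2 a b x y) = sets (ens_borel {k1..k2} {a..b})"
  by (simp add: free_law_eq)

lemma measurable_bridges_wiener:
  "a < b \<Longrightarrow> bridges K a b x y \<in> wiener_law K \<rightarrow>\<^sub>M ens_borel K {a..b}"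
  using measurable_bridges[of a b K x y] by (simp add: measurable_cong_sets[OF sets_wiener_law refl])

lemma finite_measure_free_law:
  assumes "a < b" shows "finite_measure (free_law k1 k2 a b x y)"
proof -
  have "finite_measure (wiener_law {k1..k2})"
  proof (rule wiener_law_cases)
    assume "is_wiener_law {k1..k2} (wiener_law {k1..k2})"
    then have "prob_space (wiener_law {k1..k2})"
      by (simp add: is_wiener_law_def indep_standard_BMs_def)
    then show ?thesis by (rule prob_space.finite_measure)
  qed (auto intro: finite_measureI)
  then show ?thesis
    unfolding free_law_eq by (rule finite_measure.finite_measure_distr) (rule measurable_bridges_wiener[OF assms])
qed

text \<open>Adding \<open>h\<close> to the bridges amounts to adding a parabola to the driving Brownian motions and
  moving the endpoints; the Cameron-Martin formula then expresses the first change by an area tilt.\<close>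

lemma free_law_shift:
  assumes ab: "a < b" and h: "\<And>r. h r = A / 2 * r\<^sup>2 + c * r + d"
    and x': "\<And>i. i \<in> {k1..k2} \<Longrightarrow> x' i = x i + h a"
    and y': "\<And>i. i \<in> {k1..k2} \<Longrightarrow> y' i = y i + h b"
    and g: "continuous_on {a..b} g"
  obtains C where "C > 0" and
    "distr (free_law k1 k2 a b x y) (ens_borel {k1..k2} {a..b}) (add_curve {k1..k2} {a..b} h) =
     density (free_law k1 k2 a b x' y') (\<lambda>q. ennreal (C * area_weight k1 k2 a b (\<lambda>_. A) g q))"
proof -
  let ?K = "{k1..k2}" and ?P = "wiener_law {k1..k2}"
  let ?E = "ens_borel {k1..k2} {a..b}"
  let ?T = "add_curve ?K {0..1} (parabola (A * (b - a) * sqrt (b - a)))"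
  have ch: "continuous_on {a..b} h" unfolding h[abs_def] by (intro continuous_intros)
  have \<Phi>: "bridges ?K a b x y \<in> ?P \<rightarrow>\<^sub>M ?E" for x y by (rule measurable_bridges_wiener[OF ab])
  have sh: "add_curve ?K {a..b} h \<in> ?E \<rightarrow>\<^sub>M ?E" by (rule measurable_add_curve[OF ch])
  obtain C where C: "C > 0" "\<And>w. w \<in> ens_space ?K {0..1} \<Longrightarrow> (\<And>i. i \<in> ?K \<Longrightarrow> w (i, 0) = 0) \<Longrightarrow>
    exp (path_exponent (A * (b - a) * sqrt (b - a)) ?K (\<lambda>i t w. w (i, t)) w) =
    C * area_weight k1 k2 a b (\<lambda>_. A) g (bridges ?K a b x' y' w)"
    using exp_path_exponent_eq_area_weight[OF ab g, of k1 k2 A x' y'] by blast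
  have [measurable]: "area_weight k1 k2 a b (\<lambda>_. A) g \<in> borel_measurable ?E"
    using ab g by (intro measurable_area_weight) auto
  let ?V = "\<lambda>q. ennreal (C * area_weight k1 k2 a b (\<lambda>_. A) g q)"
  have "distr (free_law k1 k2 a b x y) ?E (add_curve ?K {a..b} h) = density (free_law k1 k2 a b x' y') ?V"
  proof (rule wiener_law_cases[of ?K])
    assume P: "is_wiener_law ?K ?P"
    interpret brownian_lines ?P ?K "\<lambda>i t w. w (i, t)"
      using P by unfold_locales (auto simp: is_wiener_law_def)
    have "?T \<in> ens_borel ?K {0..1} \<rightarrow>\<^sub>M ens_borel ?K {0..1}"
      by (intro measurable_add_curve) (simp add: parabola_def[abs_def] continuous_intros)
    then have T: "?T \<in> ?P \<rightarrow>\<^sub>M ?P" by (simp add: measurable_cong_sets[OF sets_wiener_law sets_wiener_law])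
    have "distr (free_law k1 k2 a b x y) ?E (add_curve ?K {a..b} h) = distr ?P ?E (add_curve ?K {a..b} h \<circ> bridges ?K a b x y)"
      unfolding free_law_eq by (rule distr_distr[OF sh \<Phi>])
    also have "add_curve ?K {a..b} h \<circ> bridges ?K a b x y = bridges ?K a b x' y' \<circ> ?T"
      by (rule ext, unfold o_apply) (rule add_curve_bridges[OF ab h x' y'])
    also have "distr ?P ?E (bridges ?K a b x' y' \<circ> ?T) = distr (distr ?P ?P ?T) ?E (bridges ?K a b x' y')"
      by (rule distr_distr[OF \<Phi> T, symmetric])
    also have "distr ?P ?P ?T = density ?P (\<lambda>w. ennreal (exp (path_exponent (A * (b - a) * sqrt (b - a)) ?K (\<lambda>i t w. w (i, t)) w)))"
      by (rule wiener_cameron_martin[OF _ P]) simp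
    also have "\<dots> = density ?P (\<lambda>w. ?V (bridges ?K a b x' y' w))"
    proof (rule density_cong)
      have start: "AE w in ?P. \<forall>i\<in>?K. w (i, 0) = 0"
        using BM by (intro AE_finite_allI) (auto simp: standard_BM_def)
      show "AE w in ?P. ennreal (exp (path_exponent (A * (b - a) * sqrt (b - a)) ?K (\<lambda>i t w. w (i, t)) w)) =
          ?V (bridges ?K a b x' y' w)"
        using start AE_space
      proof eventually_elim
        case (elim w)
        then have "w \<in> ens_space ?K {0..1}" by (simp add: sets_eq_imp_space_eq[OF sets_wiener_law])
        from C(2)[OF this] elim(1) show ?case by metis
      qed
    qed (use \<Phi> in measurable)
    also have "distr (density ?P (\<lambda>w. ?V (bridges ?K a b x' y' w))) ?E (bridges ?K a b x' y') =
        density (distr ?P ?E (bridges ?K a b x' y')) ?V"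
      by (rule density_distr[symmetric, OF _ \<Phi>]) measurable
    finally show ?thesis unfolding free_law_eq .
  next
    assume P: "?P = null_measure (ens_borel ?K {0..1})"
    have null: "free_law k1 k2 a b x y = null_measure ?E" for x y
      using \<Phi>[of x y] unfolding free_law_eq P
      by (intro measure_eqI) (auto simp: emeasure_distr)
    show ?thesis unfolding null
      using sh by (intro measure_eqI) (auto simp: emeasure_distr emeasure_density nn_integral_null_measure)
  qed
  with C(1) show ?thesis by (rule that)
qed


section \<open>Conditioning and tilting\<close>

text \<open>Conditioning and tilting commute: both sides give a set \<open>B\<close> the mass of \<open>V\<close> on \<open>E \<inter> B\<close> divided by the
  mass of \<open>V\<close> on \<open>E\<close>, and the constant \<open>C\<close> cancels. If \<open>E\<close> is a null set, both sides are null
  measures, since dividing by zero leaves the measure of a null set at zero.\<close>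

lemma uniform_measure_tilt:
  fixes V :: "'a \<Rightarrow> real"
  assumes Q: "finite_measure Q" and E [measurable]: "E \<in> sets Q"
    and V [measurable]: "V \<in> borel_measurable Q" and pos: "\<And>q. V q > 0" and C: "C > 0"
    and fin: "finite_measure (density Q (\<lambda>q. ennreal (C * V q)))"
  shows "density (uniform_measure Q E) (\<lambda>q. ennreal (V q / (\<integral>q. V q \<partial>uniform_measure Q E))) =
    uniform_measure (density Q (\<lambda>q. ennreal (C * V q))) E"
proof (rule measure_eqI)
  let ?U = "uniform_measure Q E" and ?R = "density Q (\<lambda>q. ennreal (C * V q))"
  interpret Q: finite_measure Q by (rule Q)
  interpret R: finite_measure ?R by (rule fin)
  define Z where "Z = (\<integral>q. V q \<partial>?U)"
  define I where "I B = (\<integral>\<^sup>+q. ennreal (V q) * indicator (E \<inter> B) q \<partial>Q)" for B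
  fix B assume "B \<in> sets (density ?U (\<lambda>q. ennreal (V q / (\<integral>q. V q \<partial>?U))))"
  then have B [measurable]: "B \<in> sets Q" by simp
  have R: "emeasure ?R (E \<inter> B) = ennreal C * I B" if [measurable]: "B \<in> sets Q" for B
  proof -
    have "emeasure ?R (E \<inter> B) = (\<integral>\<^sup>+q. ennreal C * (ennreal (V q) * indicator (E \<inter> B) q) \<partial>Q)"
      using C pos by (subst emeasure_density) (auto simp: ennreal_mult less_imp_le mult.assoc intro!: nn_integral_cong)
    also have "\<dots> = ennreal C * I B"
      unfolding I_def by (rule nn_integral_cmult) measurable
    finally show ?thesis .
  qed
  have fI: "I B < \<top>" if "B \<in> sets Q" for B
  proof -
    have "ennreal C * I B < \<top>"
      using R.emeasure_finite[of "E \<inter> B"] R[OF that] by (simp add: less_top[symmetric])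
    then show ?thesis using C by (auto simp: ennreal_mult_less_top)
  qed
  have lhs: "emeasure (density ?U (\<lambda>q. ennreal (V q / Z))) B = ennreal (1 / Z) * I B / emeasure Q E"
  proof -
    have "emeasure (density ?U (\<lambda>q. ennreal (V q / Z))) B =
        (\<integral>\<^sup>+q. ennreal (V q / Z) * indicator B q \<partial>?U)"
      by (intro emeasure_density) simp_all
    also have "\<dots> = (\<integral>\<^sup>+q. ennreal (V q / Z) * indicator B q * indicator E q \<partial>Q) / emeasure Q E"
      by (intro nn_integral_uniform_measure) simp_all
    also have "(\<integral>\<^sup>+q. ennreal (V q / Z) * indicator B q * indicator E q \<partial>Q) =
        (\<integral>\<^sup>+q. ennreal (1 / Z) * (ennreal (V q) * indicator (E \<inter> B) q) \<partial>Q)"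
    proof (intro nn_integral_cong)
      fix q
      have "ennreal (V q / Z) = ennreal (1 / Z) * ennreal (V q)"
        using pos[of q] by (simp add: ennreal_mult''[symmetric] less_imp_le)
      then show "ennreal (V q / Z) * indicator B q * indicator E q =
          ennreal (1 / Z) * (ennreal (V q) * indicator (E \<inter> B) q)"
        by (simp add: indicator_def)
    qed
    also have "\<dots> = ennreal (1 / Z) * I B"
      unfolding I_def by (rule nn_integral_cmult) measurable
    finally show ?thesis .
  qed
  have rhs: "emeasure (uniform_measure ?R E) B = ennreal C * I B / (ennreal C * I (space Q))"
    using R[OF B] R[OF sets.top] by (subst emeasure_uniform_measure) simp_all
  show "emeasure (density ?U (\<lambda>q. ennreal (V q / (\<integral>q. V q \<partial>?U)))) B = emeasure (uniform_measure ?R E) B"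
  proof (cases "emeasure Q E = 0")
    case True
    have "I B = 0" for B
    proof -
      have "AE q in Q. q \<notin> E" using True E by (intro AE_not_in) (simp add: null_sets_def)
      then have "I B = (\<integral>\<^sup>+q. 0 \<partial>Q)"
        unfolding I_def by (intro nn_integral_cong_AE) (auto simp: indicator_def)
      then show ?thesis by simp
    qed
    then show ?thesis using lhs rhs by (simp add: Z_def)
  next
    case False
    define e where "e = measure Q E"
    have e: "emeasure Q E = ennreal e" "e > 0"
      using False by (auto simp: e_def Q.emeasure_eq_measure measure_nonneg zero_less_measure_iff)
    obtain j where j: "I B = ennreal j" "j \<ge> 0" using fI[OF B] by (cases "I B") auto
    obtain i where i: "I (space Q) = ennreal i" "i \<ge> 0" using fI[OF sets.top] by (cases "I (space Q)") auto
    have "I (space Q) \<noteq> 0"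
    proof
      assume "I (space Q) = 0"
      then have "AE q in Q. ennreal (V q) * indicator (E \<inter> space Q) q = 0"
        unfolding I_def by (subst (asm) nn_integral_0_iff_AE) auto
      then have "AE q in Q. q \<notin> E"
        using AE_space
      proof eventually_elim
        case (elim q)
        then show ?case using pos[of q] by (auto simp: indicator_def ennreal_eq_0_iff split: if_splits)
      qed
      moreover have "{q \<in> space Q. \<not> q \<notin> E} = E" using sets.sets_into_space[OF E] by auto
      ultimately show False using False AE_iff_measurable[OF E, of "\<lambda>q. q \<notin> E"] by blast
    qed
    then have ipos: "i > 0" using i by (auto simp: less_le)
    have "(\<integral>\<^sup>+q. ennreal (V q) \<partial>?U) = (\<integral>\<^sup>+q. ennreal (V q) * indicator E q \<partial>Q) / emeasure Q E"
      by (intro nn_integral_uniform_measure) simp_all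
    also have "(\<integral>\<^sup>+q. ennreal (V q) * indicator E q \<partial>Q) = I (space Q)"
      unfolding I_def by (intro nn_integral_cong) (auto simp: indicator_def)
    also have "I (space Q) / emeasure Q E = ennreal (i / e)"
      using i e by (simp add: divide_ennreal)
    finally have "Z = i / e"
      unfolding Z_def using pos i e
      by (subst integral_eq_nn_integral) (auto simp: less_imp_le)
    then have "ennreal (1 / Z) * I B / emeasure Q E = ennreal (j / i)"
      using i(2) j ipos e by (simp add: ennreal_mult'[symmetric] divide_ennreal)
    also have "\<dots> = ennreal C * I B / (ennreal C * I (space Q))"
      using i(1) j ipos C by (simp add: ennreal_mult'[symmetric] divide_ennreal)
    finally show ?thesis using lhs rhs by (simp add: Z_def)
  qed
qed simp

lemma uniform_measure_distr:
  assumes E': "E' \<in> sets N" and T: "T \<in> Q \<rightarrow>\<^sub>M N" and E: "E = T -` E' \<inter> space Q"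
  shows "uniform_measure (distr Q N T) E' = distr (uniform_measure Q E) N T"
proof (rule measure_eqI)
  fix B assume "B \<in> sets (uniform_measure (distr Q N T) E')"
  then have B: "B \<in> sets N" by simp
  have ES: "E \<in> sets Q" unfolding E by (rule measurable_sets[OF T E'])
  have T': "T \<in> uniform_measure Q E \<rightarrow>\<^sub>M N" using T by simp
  have "emeasure (uniform_measure (distr Q N T) E') B =
      emeasure (distr Q N T) (E' \<inter> B) / emeasure (distr Q N T) E'"
    using E' B by (intro emeasure_uniform_measure) auto
  also have "emeasure (distr Q N T) E' = emeasure Q E"
    unfolding E by (rule emeasure_distr[OF T E'])
  also have "emeasure (distr Q N T) (E' \<inter> B) = emeasure Q (E \<inter> (T -` B \<inter> space Q))"
    using E' B by (subst emeasure_distr[OF T]) (auto simp: E intro!: arg_cong[where f="emeasure Q"])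
  also have "emeasure Q (E \<inter> (T -` B \<inter> space Q)) / emeasure Q E = emeasure (uniform_measure Q E) (T -` B \<inter> space Q)"
    using ES measurable_sets[OF T B] by (intro emeasure_uniform_measure[symmetric]) auto
  also have "\<dots> = emeasure (distr (uniform_measure Q E) N T) B"
    using emeasure_distr[OF T' B] by simp
  finally show "emeasure (uniform_measure (distr Q N T) E') B = emeasure (distr (uniform_measure Q E) N T) B" .
qed simp

lemma sets_avoid_event:
  assumes k: "k1 \<le> k2" and \<phi>: "continuous_on {a..b} \<phi>" and g: "continuous_on {a..b} g"
    and f: "\<And>r. r \<in> {a..b} \<Longrightarrow> f r = (if finite_top then ereal (\<phi> r) else \<infinity>)"
  shows "avoid_event k1 k2 a b f (\<lambda>r. ereal (g r)) \<in> sets (ens_borel {k1..k2} {a..b})"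
proof -
  let ?N = "ens_borel {k1..k2} {a..b}"
  have c: "continuous_on {a..b} (\<lambda>r. q (i, r))" if "q \<in> space ?N" "i \<in> {k1..k2}" for q i
    using that by (simp add: ens_space_iff)
  have m: "(\<lambda>q. q (i, r)) \<in> borel_measurable ?N" if "i \<in> {k1..k2}" "r \<in> {a..b}" for i r
    using that by (intro measurable_ens_eval) auto
  have 1: "{q \<in> space ?N. \<forall>r\<in>{a..b}. 0 < \<phi> r - q (k1, r)} \<in> sets ?N"
    using k \<phi> c m by (intro sets_Collect_ball_pos continuous_on_diff borel_measurable_diff) auto
  have 2: "{q \<in> space ?N. \<forall>r\<in>{a..b}. 0 < q (k2, r) - g r} \<in> sets ?N"
    using k g c m by (intro sets_Collect_ball_pos continuous_on_diff borel_measurable_diff) auto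
  have 3: "{q \<in> space ?N. \<forall>i\<in>{k1..<k2}. \<forall>r\<in>{a..b}. 0 < q (i, r) - q (i + 1, r)} \<in> sets ?N"
    unfolding pred_def[symmetric]
  proof (rule pred_intros_finite(3))
    fix i assume "i \<in> {k1..<k2}"
    then have "i \<in> {k1..k2}" "i + 1 \<in> {k1..k2}" by auto
    then show "Measurable.pred ?N (\<lambda>q. \<forall>r\<in>{a..b}. 0 < q (i, r) - q (i + 1, r))"
      unfolding pred_def using c m
      by (intro sets_Collect_ball_pos continuous_on_diff borel_measurable_diff) auto
  qed simp
  have "avoid_event k1 k2 a b f (\<lambda>r. ereal (g r)) =
      (if finite_top then {q \<in> space ?N. \<forall>r\<in>{a..b}. 0 < \<phi> r - q (k1, r)} else space ?N) \<inter>
      {q \<in> space ?N. \<forall>i\<in>{k1..<k2}. \<forall>r\<in>{a..b}. 0 < q (i, r) - q (i + 1, r)} \<inter>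
      {q \<in> space ?N. \<forall>r\<in>{a..b}. 0 < q (k2, r) - g r}"
    unfolding avoid_event_def by (auto simp: f)
  also have "\<dots> \<in> sets ?N"
    by (intro sets.Int 2 3) (use 1 sets.top[of ?N] in \<open>auto simp del: space_ens_borel\<close>)
  finally show ?thesis .
qed

text \<open>Adding the same curve to all lines and to both boundaries preserves every strict
  inequality between them; an infinite upper boundary stays infinite.\<close>

lemma avoid_event_add_curve:
  assumes k: "k1 \<le> k2" and h: "continuous_on {a..b} h"
    and f: "\<And>r. r \<in> {a..b} \<Longrightarrow> f' r = f r + ereal (h r)"
    and g: "\<And>r. r \<in> {a..b} \<Longrightarrow> g' r = g r + h r"
  shows "avoid_event k1 k2 a b f (\<lambda>r. ereal (g r)) =
    add_curve {k1..k2} {a..b} h -` avoid_event k1 k2 a b f' (\<lambda>r. ereal (g' r)) \<inter> ens_space {k1..k2} {a..b}"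
proof -
  have lt: "ereal (u + w) < z + ereal w \<longleftrightarrow> ereal u < z" for u w z
    by (cases z) auto
  have "q \<in> avoid_event k1 k2 a b f (\<lambda>r. ereal (g r)) \<longleftrightarrow>
      add_curve {k1..k2} {a..b} h q \<in> avoid_event k1 k2 a b f' (\<lambda>r. ereal (g' r))"
    if q: "q \<in> ens_space {k1..k2} {a..b}" for q
    using q add_curve_in_ens_space[OF q h] k unfolding avoid_event_def
    by (auto simp: add_curve_apply f g lt)
  moreover have "avoid_event k1 k2 a b f (\<lambda>r. ereal (g r)) \<subseteq> ens_space {k1..k2} {a..b}"
    by (auto simp: avoid_event_def)
  ultimately show ?thesis by blast
qed

lemma tilted_law_zero:
  assumes k: "k1 \<le> k2" and ab: "a < b"
    and E: "avoid_event k1 k2 a b f (\<lambda>r. ereal (g r)) \<in> sets (ens_borel {k1..k2} {a..b})"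
  shows "tilted_law k1 k2 a b (\<lambda>_. 0) x y f g = avoid_law k1 k2 a b x y f (\<lambda>r. ereal (g r))"
proof -
  have w: "area_weight k1 k2 a b (\<lambda>_. 0) g = (\<lambda>_. 1)" by (rule ext) (simp add: area_weight_def)
  have d: "density (free_law k1 k2 a b x y) (\<lambda>q. ennreal (1 * 1)) = free_law k1 k2 a b x y"
    by (simp add: density_1)
  have fin: "finite_measure (free_law k1 k2 a b x y)" by (rule finite_measure_free_law[OF ab])
  show ?thesis
    unfolding tilted_law_def Let_def w avoid_law_def
    using uniform_measure_tilt[of "free_law k1 k2 a b x y" "avoid_event k1 k2 a b f (\<lambda>r. ereal (g r))" "\<lambda>_. 1" 1]
      fin E by (simp add: d[simplified])
qed

text \<open>The tilt produced by \<open>free_law_shift\<close> may be written with the shifted lower boundary \<open>g'\<close>,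
  since a change of the lower boundary only changes the constant that conditioning removes.\<close>

lemma tilted_law_add_curve:
  assumes k: "k1 \<le> k2" and ab: "a < b" and h: "\<And>r. h r = A / 2 * r\<^sup>2 + c * r + d"
    and x': "\<And>i. i \<in> {k1..k2} \<Longrightarrow> x' i = x i + h a"
    and y': "\<And>i. i \<in> {k1..k2} \<Longrightarrow> y' i = y i + h b"
    and \<phi>: "continuous_on {a..b} \<phi>" and g: "continuous_on {a..b} g"
    and f: "\<And>r. r \<in> {a..b} \<Longrightarrow> f r = (if finite_top then ereal (\<phi> r) else \<infinity>)"
    and f': "\<And>r. r \<in> {a..b} \<Longrightarrow> f' r = f r + ereal (h r)"
    and g': "\<And>r. r \<in> {a..b} \<Longrightarrow> g' r = g r + h r"
  shows "tilted_law k1 k2 a b (\<lambda>_. A) x' y' f' g' =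
    distr (tilted_law k1 k2 a b (\<lambda>_. 0) x y f g) (ens_borel {k1..k2} {a..b}) (add_curve {k1..k2} {a..b} h)"
proof -
  let ?N = "ens_borel {k1..k2} {a..b}" and ?sh = "add_curve {k1..k2} {a..b} h"
  let ?Q = "free_law k1 k2 a b x y" and ?Q' = "free_law k1 k2 a b x' y'"
  let ?E = "avoid_event k1 k2 a b f (\<lambda>r. ereal (g r))" and ?E' = "avoid_event k1 k2 a b f' (\<lambda>r. ereal (g' r))"
  let ?V = "area_weight k1 k2 a b (\<lambda>_. A) g'"
  have ch: "continuous_on {a..b} h" unfolding h[abs_def] by (intro continuous_intros)
  have cg': "continuous_on {a..b} g'"
    by (rule continuous_on_eq[OF continuous_on_add[OF g ch]]) (simp add: g')
  have E: "?E \<in> sets ?N" by (rule sets_avoid_event[OF k \<phi> g f])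
  have E': "?E' \<in> sets ?N"
  proof (rule sets_avoid_event[OF k _ cg'])
    show "continuous_on {a..b} (\<lambda>r. \<phi> r + h r)" by (intro continuous_on_add \<phi> ch)
    show "f' r = (if finite_top then ereal (\<phi> r + h r) else \<infinity>)" if "r \<in> {a..b}" for r
      using f[OF that] f'[OF that] by simp
  qed
  have sh: "?sh \<in> ?Q \<rightarrow>\<^sub>M ?N"
    using measurable_add_curve[OF ch, of "{k1..k2}"] by (simp add: measurable_cong_sets[OF sets_free_law refl])
  obtain C where C: "C > 0" "distr ?Q ?N ?sh = density ?Q' (\<lambda>q. ennreal (C * ?V q))"
    using free_law_shift[where ?k1.0=k1 and ?k2.0=k2 and x=x and x'=x' and y=y and y'=y', OF ab h x' y' cg']
    by blast
  have V: "?V \<in> borel_measurable ?Q'"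
    using measurable_area_weight[OF _ cg', of k1 k2 "\<lambda>_. A"] ab
    by (simp add: measurable_cong_sets[OF sets_free_law refl])
  have "tilted_law k1 k2 a b (\<lambda>_. A) x' y' f' g' = uniform_measure (density ?Q' (\<lambda>q. ennreal (C * ?V q))) ?E'"
    unfolding tilted_law_def Let_def avoid_law_def
  proof (rule uniform_measure_tilt[OF finite_measure_free_law[OF ab] _ V _ C(1)])
    show "?E' \<in> sets ?Q'" using E' by simp
    show "finite_measure (density ?Q' (\<lambda>q. ennreal (C * ?V q)))"
      unfolding C(2)[symmetric] by (rule finite_measure.finite_measure_distr[OF finite_measure_free_law[OF ab] sh])
  qed (simp add: area_weight_def)
  also have "\<dots> = distr (uniform_measure ?Q ?E) ?N ?sh"
    unfolding C(2)[symmetric]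
    using avoid_event_add_curve[OF k ch f' g'] sets_eq_imp_space_eq[OF sets_free_law, of k1 k2 a b x y]
    by (intro uniform_measure_distr E' sh) simp
  also have "uniform_measure ?Q ?E = tilted_law k1 k2 a b (\<lambda>_. 0) x y f g"
    unfolding tilted_law_zero[OF k ab E] avoid_law_def ..
  finally show ?thesis .
qed

lemma sets_tilted_law: "sets (tilted_law k1 k2 a b A x y f g) = sets (ens_borel {k1..k2} {a..b})"
  by (simp add: tilted_law_def Let_def avoid_law_def)


section \<open>The Gibbs property under a shift\<close>

definition gibbs_identity ::
  "'w measure \<Rightarrow> enat \<Rightarrow> real set \<Rightarrow> (int \<Rightarrow> real) \<Rightarrow> ('w \<Rightarrow> int \<times> real \<Rightarrow> real) \<Rightarrow>
   int \<Rightarrow> int \<Rightarrow> real \<Rightarrow> real \<Rightarrow> ((int \<times> real \<Rightarrow> real) \<Rightarrow> real) \<Rightarrow> bool" where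
  "gibbs_identity M N \<Lambda> A L k1 k2 a b F \<longleftrightarrow>
     (AE \<omega> in M.
        real_cond_exp M (ext_sigma M (index_set N) \<Lambda> L {k1..k2} a b)
          (\<lambda>\<omega>. F (restrict (L \<omega>) ({k1..k2} \<times> {a..b}))) \<omega> =
        (\<integral>q. F q \<partial>tilted_law k1 k2 a b A
           (\<lambda>i. L \<omega> (i, a)) (\<lambda>i. L \<omega> (i, b))
           (\<lambda>r. if k1 - 1 \<in> index_set N then ereal (L \<omega> (k1 - 1, r)) else \<infinity>)
           (\<lambda>r. L \<omega> (k2 + 1, r))))"

text \<open>Equality on extensional functions is needed, not just on the path space: off the sample space an
  ensemble need not have continuous paths, but its restrictions are still extensional.\<close>

lemma gibbs_identity_cong:
  assumes "\<And>q. q \<in> extensional ({k1..k2} \<times> {a..b}) \<Longrightarrow> F q = F' q"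
  shows "gibbs_identity M N \<Lambda> A L k1 k2 a b F \<longleftrightarrow> gibbs_identity M N \<Lambda> A L k1 k2 a b F'"
proof -
  have 1: "F (restrict q ({k1..k2} \<times> {a..b})) = F' (restrict q ({k1..k2} \<times> {a..b}))" for q
    by (rule assms) simp
  have 2: "(\<integral>q. F q \<partial>tilted_law k1 k2 a b A x y f g) = (\<integral>q. F' q \<partial>tilted_law k1 k2 a b A x y f g)"
    for x y f g
    by (intro Bochner_Integration.integral_cong refl assms)
       (simp add: sets_eq_imp_space_eq[OF sets_tilted_law] ens_space_iff)
  show ?thesis unfolding gibbs_identity_def 1 2 ..
qed

text \<open>At each point the two ensembles differ by a constant, and translations of the real line preserve
  Borel sets.\<close>

lemma ext_sigma_add_curve:
  "ext_sigma M S T (\<lambda>\<omega>. add_curve S T h (L \<omega>)) K a b = ext_sigma M S T L K a b"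
proof -
  have sub: "{(\<lambda>\<omega>. L1 \<omega> p) -` B \<inter> space M | p B. p \<in> (S \<times> T) - (K \<times> {a<..<b}) \<and> B \<in> sets borel}
      \<subseteq> {(\<lambda>\<omega>. L2 \<omega> p) -` B \<inter> space M | p B. p \<in> (S \<times> T) - (K \<times> {a<..<b}) \<and> B \<in> sets borel}"
    if L: "\<And>\<omega> p. p \<in> S \<times> T \<Longrightarrow> L1 \<omega> p = L2 \<omega> p + c p"
    for L1 L2 :: "'a \<Rightarrow> int \<times> real \<Rightarrow> real" and c
  proof
    fix X assume "X \<in> {(\<lambda>\<omega>. L1 \<omega> p) -` B \<inter> space M | p B. p \<in> (S \<times> T) - (K \<times> {a<..<b}) \<and> B \<in> sets borel}"
    then obtain p and B :: "real set" where X: "X = (\<lambda>\<omega>. L1 \<omega> p) -` B \<inter> space M"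
      and p: "p \<in> (S \<times> T) - (K \<times> {a<..<b})" and B: "B \<in> sets borel" by blast
    let ?B = "(\<lambda>u. u + c p) -` B"
    have "(\<lambda>u. u + c p) \<in> borel_measurable borel" by measurable
    then have "?B \<in> sets borel" using B by (rule measurable_sets_borel)
    moreover have "X = (\<lambda>\<omega>. L2 \<omega> p) -` ?B \<inter> space M"
      using L[of p] p unfolding X by auto
    ultimately show "X \<in> {(\<lambda>\<omega>. L2 \<omega> p) -` B \<inter> space M | p B. p \<in> (S \<times> T) - (K \<times> {a<..<b}) \<and> B \<in> sets borel}"
      using p by blast
  qed
  let ?L' = "\<lambda>\<omega>. add_curve S T h (L \<omega>)"
  have "{(\<lambda>\<omega>. ?L' \<omega> p) -` B \<inter> space M | p B. p \<in> (S \<times> T) - (K \<times> {a<..<b}) \<and> B \<in> sets borel} =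
      {(\<lambda>\<omega>. L \<omega> p) -` B \<inter> space M | p B. p \<in> (S \<times> T) - (K \<times> {a<..<b}) \<and> B \<in> sets borel}"
  proof (rule equalityI)
    show "{(\<lambda>\<omega>. ?L' \<omega> p) -` B \<inter> space M | p B. p \<in> (S \<times> T) - (K \<times> {a<..<b}) \<and> B \<in> sets borel}
      \<subseteq> {(\<lambda>\<omega>. L \<omega> p) -` B \<inter> space M | p B. p \<in> (S \<times> T) - (K \<times> {a<..<b}) \<and> B \<in> sets borel}"
      by (rule sub[where c="\<lambda>p. h (snd p)"]) (auto simp: add_curve_def)
    show "{(\<lambda>\<omega>. L \<omega> p) -` B \<inter> space M | p B. p \<in> (S \<times> T) - (K \<times> {a<..<b}) \<and> B \<in> sets borel}
      \<subseteq> {(\<lambda>\<omega>. ?L' \<omega> p) -` B \<inter> space M | p B. p \<in> (S \<times> T) - (K \<times> {a<..<b}) \<and> B \<in> sets borel}"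
      by (rule sub[where c="\<lambda>p. - h (snd p)"]) (auto simp: add_curve_def)
  qed
  then show ?thesis by (simp only: ext_sigma_def)
qed

lemma restrict_add_curve:
  assumes "K \<subseteq> S" "I \<subseteq> T"
  shows "restrict (add_curve S T h q) (K \<times> I) = add_curve K I h (restrict q (K \<times> I))"
  using assms by (auto simp: add_curve_def fun_eq_iff)

text \<open>The conditional expectations on both sides are literally the same function, because the external
  \<open>\<sigma>\<close>-algebras coincide; the laws on the right-hand sides are related by a push-forward.\<close>

lemma gibbs_identity_add_curve:
  assumes L: "line_ensemble M (index_set N) \<Lambda> L"
    and h: "\<And>r. h r = A / 2 * r\<^sup>2 + c * r + d"
    and k: "k1 \<le> k2" "{k1..k2} \<subseteq> index_set N" "enat (nat (k2 + 1)) \<le> N"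
    and ab: "a < b" "{a..b} \<subseteq> \<Lambda>"
    and F: "F \<in> borel_measurable (ens_borel {k1..k2} {a..b})"
  shows "gibbs_identity M N \<Lambda> (\<lambda>_. A) (\<lambda>\<omega>. add_curve (index_set N) \<Lambda> h (L \<omega>)) k1 k2 a b F \<longleftrightarrow>
    gibbs_identity M N \<Lambda> (\<lambda>_. 0) L k1 k2 a b (\<lambda>q. F (add_curve {k1..k2} {a..b} h q))"
  unfolding gibbs_identity_def ext_sigma_add_curve restrict_add_curve[OF k(2) ab(2)]
proof (rule AE_cong)
  let ?S = "index_set N" and ?L' = "\<lambda>\<omega>. add_curve (index_set N) \<Lambda> h (L \<omega>)"
  let ?f = "\<lambda>L r. if k1 - 1 \<in> ?S then ereal (L (k1 - 1, r)) else \<infinity>"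
  fix \<omega> assume \<omega>: "\<omega> \<in> space M"
  have "L \<in> M \<rightarrow>\<^sub>M ens_borel ?S \<Lambda>" using L by (simp add: line_ensemble_def)
  from measurable_space[OF this \<omega>] have q: "L \<omega> \<in> ens_space ?S \<Lambda>" by simp
  have "k1 \<in> ?S" using k(1,2) by (meson atLeastAtMost_iff order_refl subsetD)
  then have "1 \<le> k1" by (simp add: index_set_def)
  then have k2: "k2 + 1 \<in> ?S" using k(1,3) by (simp add: index_set_def)
  have abL: "a \<in> \<Lambda>" "b \<in> \<Lambda>" using ab by auto
  have cont: "continuous_on {a..b} (\<lambda>r. L \<omega> (i, r))" if "i \<in> ?S" for i
    using q that continuous_on_subset[OF _ ab(2)] by (auto simp: ens_space_iff)
  have ch: "continuous_on {a..b} h" unfolding h[abs_def] by (intro continuous_intros)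
  have sh: "add_curve {k1..k2} {a..b} h \<in>
      tilted_law k1 k2 a b (\<lambda>_. 0) x y f g \<rightarrow>\<^sub>M ens_borel {k1..k2} {a..b}" for x y f g
    using measurable_add_curve[OF ch] by (simp add: measurable_cong_sets[OF sets_tilted_law refl])
  have "tilted_law k1 k2 a b (\<lambda>_. A) (\<lambda>i. ?L' \<omega> (i, a)) (\<lambda>i. ?L' \<omega> (i, b)) (?f (?L' \<omega>)) (\<lambda>r. ?L' \<omega> (k2 + 1, r)) =
    distr (tilted_law k1 k2 a b (\<lambda>_. 0) (\<lambda>i. L \<omega> (i, a)) (\<lambda>i. L \<omega> (i, b)) (?f (L \<omega>)) (\<lambda>r. L \<omega> (k2 + 1, r)))
      (ens_borel {k1..k2} {a..b}) (add_curve {k1..k2} {a..b} h)"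
  proof (rule tilted_law_add_curve[OF k(1) ab(1) h])
    show "add_curve ?S \<Lambda> h (L \<omega>) (i, a) = L \<omega> (i, a) + h a" if "i \<in> {k1..k2}" for i
      using that k(2) abL by (intro add_curve_apply) auto
    show "add_curve ?S \<Lambda> h (L \<omega>) (i, b) = L \<omega> (i, b) + h b" if "i \<in> {k1..k2}" for i
      using that k(2) abL by (intro add_curve_apply) auto
    show "continuous_on {a..b} (\<lambda>r. if k1 - 1 \<in> ?S then L \<omega> (k1 - 1, r) else 0)"
      using cont[of "k1 - 1"] by (cases "k1 - 1 \<in> ?S") auto
    show "continuous_on {a..b} (\<lambda>r. L \<omega> (k2 + 1, r))" by (rule cont[OF k2])
    show "?f (L \<omega>) r = (if k1 - 1 \<in> ?S then ereal (if k1 - 1 \<in> ?S then L \<omega> (k1 - 1, r) else 0) else \<infinity>)" for r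
      by simp
    show "?f (?L' \<omega>) r = ?f (L \<omega>) r + ereal (h r)" if "r \<in> {a..b}" for r
      using that ab(2) by (auto simp: add_curve_apply)
    show "?L' \<omega> (k2 + 1, r) = L \<omega> (k2 + 1, r) + h r" if "r \<in> {a..b}" for r
      using that ab(2) k2 by (intro add_curve_apply) auto
  qed
  then have "(\<integral>q. F q \<partial>tilted_law k1 k2 a b (\<lambda>_. A) (\<lambda>i. ?L' \<omega> (i, a)) (\<lambda>i. ?L' \<omega> (i, b)) (?f (?L' \<omega>)) (\<lambda>r. ?L' \<omega> (k2 + 1, r))) =
    (\<integral>q. F (add_curve {k1..k2} {a..b} h q) \<partial>tilted_law k1 k2 a b (\<lambda>_. 0) (\<lambda>i. L \<omega> (i, a)) (\<lambda>i. L \<omega> (i, b))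
      (?f (L \<omega>)) (\<lambda>r. L \<omega> (k2 + 1, r)))"
    using integral_distr[OF sh F] by simp
  then show "real_cond_exp M (ext_sigma M ?S \<Lambda> L {k1..k2} a b)
        (\<lambda>\<omega>. F (add_curve {k1..k2} {a..b} h (restrict (L \<omega>) ({k1..k2} \<times> {a..b})))) \<omega> =
      (\<integral>q. F q \<partial>tilted_law k1 k2 a b (\<lambda>_. A) (\<lambda>i. ?L' \<omega> (i, a)) (\<lambda>i. ?L' \<omega> (i, b)) (?f (?L' \<omega>)) (\<lambda>r. ?L' \<omega> (k2 + 1, r)))
    \<longleftrightarrow> real_cond_exp M (ext_sigma M ?S \<Lambda> L {k1..k2} a b)
        (\<lambda>\<omega>. F (add_curve {k1..k2} {a..b} h (restrict (L \<omega>) ({k1..k2} \<times> {a..b})))) \<omega> =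
      (\<integral>q. F (add_curve {k1..k2} {a..b} h q) \<partial>tilted_law k1 k2 a b (\<lambda>_. 0) (\<lambda>i. L \<omega> (i, a)) (\<lambda>i. L \<omega> (i, b))
      (?f (L \<omega>)) (\<lambda>r. L \<omega> (k2 + 1, r)))"
    by simp
qed

lemma non_intersecting_add_curve:
  "non_intersecting M S T (\<lambda>\<omega>. add_curve S T h (L \<omega>)) \<longleftrightarrow> non_intersecting M S T L"
  by (simp add: non_intersecting_def add_curve_apply)

lemma line_ensemble_add_curve:
  assumes "line_ensemble M S T L" "continuous_on T h"
  shows "line_ensemble M S T (\<lambda>\<omega>. add_curve S T h (L \<omega>))"
  using assms measurable_compose[OF _ measurable_add_curve] by (auto simp: line_ensemble_def)

theorem lemma2p4:
  fixes M :: "'w measure" and N :: enat and \<Lambda> :: "real set" and A c d :: real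
    and h :: "real \<Rightarrow> real" and L L' :: "'w \<Rightarrow> int \<times> real \<Rightarrow> real"
  assumes "1 \<le> N" and "is_interval \<Lambda>" and "0 \<le> A"
    and "\<And>x. h x = (A / 2) * x\<^sup>2 + c * x + d"
    and "line_ensemble M (index_set N) \<Lambda> L"
    and "\<And>\<omega>. L' \<omega> = (\<lambda>(i, s)\<in>index_set N \<times> \<Lambda>. L \<omega> (i, s) + h s)"
  shows "partial_Gibbs M N \<Lambda> L \<longleftrightarrow> tilted_partial_Gibbs M N \<Lambda> (\<lambda>_. A) L'"
proof -
  let ?S = "index_set N"
  note h = assms(4) and L = assms(5)
  have L': "L' = (\<lambda>\<omega>. add_curve ?S \<Lambda> h (L \<omega>))"
    using assms(6) by (simp add: fun_eq_iff add_curve_def)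
  have ch: "continuous_on T h" for T unfolding h[abs_def] by (intro continuous_intros)
  define admissible :: "int \<Rightarrow> int \<Rightarrow> real \<Rightarrow> real \<Rightarrow> ((int \<times> real \<Rightarrow> real) \<Rightarrow> real) \<Rightarrow> bool" where
    "admissible k1 k2 a b F \<longleftrightarrow> k1 \<le> k2 \<and> {k1..k2} \<subseteq> ?S \<and> enat (nat (k2 + 1)) \<le> N \<and>
        a < b \<and> {a..b} \<subseteq> \<Lambda> \<and>
        F \<in> borel_measurable (ens_borel {k1..k2} {a..b}) \<and>
        bounded (F ` ens_space {k1..k2} {a..b})" for k1 k2 a b F
  have shifted: "admissible k1 k2 a b (\<lambda>q. F (add_curve {k1..k2} {a..b} u q))"
    if F: "admissible k1 k2 a b F" and u: "continuous_on {a..b} u" for k1 k2 a b F u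
  proof -
    have "F \<in> borel_measurable (ens_borel {k1..k2} {a..b})"
      using F by (simp only: admissible_def)
    then have "(\<lambda>q. F (add_curve {k1..k2} {a..b} u q)) \<in> borel_measurable (ens_borel {k1..k2} {a..b})"
      by (rule measurable_compose[OF measurable_add_curve[OF u]])
    moreover have "bounded ((\<lambda>q. F (add_curve {k1..k2} {a..b} u q)) ` ens_space {k1..k2} {a..b})"
    proof (rule bounded_subset)
      show "bounded (F ` ens_space {k1..k2} {a..b})" using F by (simp only: admissible_def)
    qed (use add_curve_in_ens_space[OF _ u] in blast)
    ultimately show ?thesis using F by (simp only: admissible_def)
  qed
  have step: "gibbs_identity M N \<Lambda> (\<lambda>_. A) L' k1 k2 a b F \<longleftrightarrow>
      gibbs_identity M N \<Lambda> (\<lambda>_. 0) L k1 k2 a b (\<lambda>q. F (add_curve {k1..k2} {a..b} h q))"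
    if "admissible k1 k2 a b F" for k1 k2 a b F
    using that unfolding L' admissible_def by (elim conjE) (rule gibbs_identity_add_curve[OF L h])
  have "(\<forall>k1 k2 a b F. admissible k1 k2 a b F \<longrightarrow> gibbs_identity M N \<Lambda> (\<lambda>_. 0) L k1 k2 a b F) \<longleftrightarrow>
      (\<forall>k1 k2 a b F. admissible k1 k2 a b F \<longrightarrow> gibbs_identity M N \<Lambda> (\<lambda>_. A) L' k1 k2 a b F)"
  proof (intro iffI allI impI)
    fix k1 k2 a b F
    assume *: "\<forall>k1 k2 a b F. admissible k1 k2 a b F \<longrightarrow> gibbs_identity M N \<Lambda> (\<lambda>_. 0) L k1 k2 a b F"
      and F: "admissible k1 k2 a b F"
    then show "gibbs_identity M N \<Lambda> (\<lambda>_. A) L' k1 k2 a b F"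
      using shifted[OF F ch] step[OF F] by blast
  next
    fix k1 k2 a b F
    assume *: "\<forall>k1 k2 a b F. admissible k1 k2 a b F \<longrightarrow> gibbs_identity M N \<Lambda> (\<lambda>_. A) L' k1 k2 a b F"
      and F: "admissible k1 k2 a b F"
    \<comment> \<open>The test function whose shift by \<open>h\<close> is \<open>F\<close>.\<close>
    let ?F = "\<lambda>q. F (add_curve {k1..k2} {a..b} (\<lambda>s. - h s) q)"
    have F': "admissible k1 k2 a b ?F" by (intro shifted F continuous_on_minus ch)
    then have "gibbs_identity M N \<Lambda> (\<lambda>_. 0) L k1 k2 a b (\<lambda>q. ?F (add_curve {k1..k2} {a..b} h q))"
      using * step[OF F'] by blast
    then show "gibbs_identity M N \<Lambda> (\<lambda>_. 0) L k1 k2 a b F"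
      by (rule gibbs_identity_cong[THEN iffD1, rotated]) (simp add: add_curve_uminus_add_curve)
  qed
  then show ?thesis
    using L line_ensemble_add_curve[OF L ch] non_intersecting_add_curve[of M ?S \<Lambda> h L]
    unfolding partial_Gibbs_def tilted_partial_Gibbs_def gibbs_identity_def[symmetric] admissible_def
    by (simp only: L')
qed

end
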